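(* (i) For all $n\in\mathbb{N}$ the section by $H_{a_{\min}}$ is locally volume-minimal in the following sense: for all $a\in\mathbb{R}^{n+1}$ with $\|a\|=1$, $\sum_{j=1}^{n+1}a_j=0$ and $a_1\ge 0\ge a_2,\dots,a_{n+1}$ we have $$\operatorname{vol}_{n-1}(H_a\cap S)\ge\operatorname{vol}_{n-1}(H_{a_{\min}}\cap S).$$ (ii) For $n=2,3$ and $4$ the section by $H_{a_{\min}}$ is globally volume-minimal, i.e. for all $a\in\mathbb{R}^{n+1}$ with $\|a\|=1$ and $\sum_{j=1}^{n+1}a_j=0$ we have $$\operatorname{vol}_{n-1}(H_a\cap S)\ge\operatorname{vol}_{n-1}(H_{a_{\min}}\cap S).$$
   Context: $S:=\{x\in\mathbb{R}^{n+1}\mid \sum_{j=1}^{n+1}x_j=1,\ x_j\ge 0\}$ is the regular $n$-simplex embedded in $\mathbb{R}^{n+1}$. $\|\cdot\|$ is the Euclidean norm and $\langle\cdot,\cdot\rangle$ the standard scalar product. $H_a:=\{x\in\mathbb{R}^{n+1}\mid\langle a,x\rangle=0\}$. $\operatorname{vol}_{n-1}$ is the $(n-1)$-dimensional Lebesgue volume within the affine subspace $H_a\cap\{\sum_j x_j=1\}$ containing the section. The special direction is $a_{\min}:=\left(\sqrt{\frac{n}{n+1}},-\frac{1}{\sqrt{n(n+1)}},\dots,-\frac{1}{\sqrt{n(n+1)}}\right)\in\mathbb{R}^{n+1}$. *)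

theory Defs
  imports "HOL-Analysis.Analysis"
begin

definition orthonormal_basis_of :: "'a::euclidean_space set \<Rightarrow> 'a set \<Rightarrow> bool" where
  "orthonormal_basis_of V B \<longleftrightarrow>
     pairwise orthogonal B \<and> (\<forall>b\<in>B. norm b = 1) \<and> span B = V"

(* Lebesgue measure of dimension aff_dim A carried by a nonempty affine subspace A:
   the completed push-forward of the product measure of one-dimensional Lebesgue measures
   along an isometric parametrisation of A (compare the definitions of lborel and
   lebesgue). Since Lebesgue measure is invariant under isometries, it does not depend on
   the choice of base point and orthonormal basis. On a single point it is the counting
   measure. *)
definition affine_lebesgue :: "'a::euclidean_space set \<Rightarrow> 'a measure" where
  "affine_lebesgue A =
     (let p = (SOME p. p \<in> A);
          B = (SOME B. orthonormal_basis_of ((\<lambda>x. x - p) ` A) B)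
      in completion
           (distr (\<Pi>\<^sub>M b\<in>B. lborel) borel (\<lambda>c. p + (\<Sum>b\<in>B. c b *\<^sub>R b))))"

(* The index type plays the role of {1, ..., n+1}. *)
definition regular_simplex :: "(real ^ 'n) set" where
  "regular_simplex = {x. (\<Sum>j\<in>UNIV. x $ j) = 1 \<and> (\<forall>j. x $ j \<ge> 0)}"

definition hyperplane0 :: "real ^ 'n \<Rightarrow> (real ^ 'n) set" where
  "hyperplane0 a = {x. a \<bullet> x = 0}"

(* For a \<noteq> 0 with coordinate sum 0 the affine subspace used here has dimension n-1. *)
definition section_vol :: "real ^ 'n \<Rightarrow> ennreal" where
  "section_vol a =
     emeasure (affine_lebesgue (hyperplane0 a \<inter> {x. (\<Sum>j\<in>UNIV. x $ j) = 1}))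
       (hyperplane0 a \<inter> regular_simplex)"

(* i is the index of the distinguished first coordinate; CARD('n) = n + 1 is intended. *)
definition a_min :: "nat \<Rightarrow> 'n \<Rightarrow> real ^ 'n" where
  "a_min n i = (\<chi> j. if j = i then sqrt (real n / (real n + 1))
                     else - 1 / sqrt (real n * (real n + 1)))"

end

theory Submission
  imports Defs
begin

text \<open>
  Write $N = n + 1$ for the number of coordinates, and let $a$ be a unit vector with coordinate
  sum $0$. The section $K$ of the simplex is the slice at height $1$ of the cone of nonnegative
  vectors orthogonal to $a$, height being the coordinate sum. Cut this cone off at
  height $1$ and thicken it by a unit segment in direction $a$: the resulting prism
  (\<open>cone_prism\<close>) has $N$-dimensional volume equal to the volume of $K$ times a factor that
  depends on $N$ only (\<open>emeasure_cone_prism\<close>), because the slice at height $t$ is $K$ scaled by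
  $t$. So volumes of prisms may be compared instead, and these are accessible to linear changes of
  variables.

  If $a_i > 0$, a linear map of determinant $a_i$ replaces the $i$-th coordinate by
  $\langle a, y \rangle$ and turns the prism into the product of $[0,1]$ with the polytope of all
  $z \ge 0$ in the other coordinates satisfying $\sum a_j z_j \le 0$ and
  $\sum (1 - a_j/a_i) z_j \le 1$ (\<open>measure_chamber\<close>).

  If all other $a_j$ are nonpositive, the first inequality is vacuous and the polytope is a corner
  simplex, so that the volume is a constant times $a_i^{-1} \prod_{j\ne i} (1 - a_j/a_i)^{-1}$.
  Since $\sum_{j \ne i} (1 - a_j/a_i) = n + 1$, the product is bounded by the inequality between the
  arithmetic and geometric means, and $a_i$ is bounded by the Cauchy-Schwarz inequality; both bounds
  are attained at \<open>a_min\<close>. This is the first claim.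

  If exactly two coordinates $a_i \ge a_k$ are positive, the polytope is a corner simplex minus a
  sheared corner simplex, which yields the volume as a constant times a divided difference
  $G(a_k) = (Q(a_i) - Q(a_k))/(a_i - a_k)$ of $Q(t) = \prod_{j \ne i,k} t/(t - a_j)$; the case
  $a_i = a_k$ is a limit (\<open>measure_cone_prism_two_positive\<close>). For $N = 4, 5$ the quantity $G(a_k)$
  is an explicit rational function, and after scaling $a_i + a_k$ to $1$ the desired bound is a
  polynomial inequality in elementary symmetric functions.

  For $n \le 4$ these cases suffice: replacing $a$ by $-a$ does not change the section, and among
  at most five coordinates either the positive or the negative ones number at most two.
\<close>

section \<open>Linear images of sets in coordinate spaces over arbitrary finite index types\<close>

text \<open>
  Carries the change of variables formula for linear maps, which concerns wellordered index types,
  over to every finite index type: a copy of the index type is wellordered by an arbitrary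
  enumeration, and relabelling the coordinates changes neither measures nor inner products.
\<close>

typedef 'n idx = "UNIV :: 'n set" ..

instance idx :: (finite) finite
proof
  have "surj (Abs_idx :: 'a \<Rightarrow> 'a idx)"
    by (metis Rep_idx_inverse surjI)
  then show "finite (UNIV :: 'a idx set)"
    by (metis finite_imageI finite_class.finite_UNIV)
qed

instantiation idx :: (finite) linorder
begin
definition less_eq_idx :: "'a idx \<Rightarrow> 'a idx \<Rightarrow> bool" where "less_eq_idx x y \<longleftrightarrow> to_nat (Rep_idx x) \<le> to_nat (Rep_idx y)"
definition less_idx :: "'a idx \<Rightarrow> 'a idx \<Rightarrow> bool" where "less_idx x y \<longleftrightarrow> to_nat (Rep_idx x) < to_nat (Rep_idx y)"
instance
  by standard (auto simp: less_eq_idx_def less_idx_def Rep_idx_inject)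
end

instance idx :: (finite) wellorder
proof (rule wf_wellorderI)
  have "{(x :: 'a idx, y). x < y} = inv_image less_than (\<lambda>x. to_nat (Rep_idx x))"
    by (auto simp: less_idx_def)
  then show "wf {(x :: 'a idx, y). x < y}" by simp
qed intro_classes

lemma Abs_idx_inv [simp]: "Rep_idx (Abs_idx x) = x"
  by (simp add: Abs_idx_inverse)

lemma bij_Rep_idx: "bij (Rep_idx :: 'n idx \<Rightarrow> 'n)"
  by (metis Abs_idx_inv Rep_idx_inverse bij_betw_byWitness subset_UNIV)

lemma sum_idx: "(\<Sum>j\<in>UNIV. f (Rep_idx j)) = (\<Sum>j\<in>UNIV. f j)"
  using sum.reindex_bij_betw[OF bij_Rep_idx] .

definition to_idx :: "real ^ 'n \<Rightarrow> real ^ 'n idx" where "to_idx x = (\<chi> j. x $ Rep_idx j)"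
definition of_idx :: "real ^ 'n idx \<Rightarrow> real ^ 'n" where "of_idx x = (\<chi> j. x $ Abs_idx j)"

lemma of_to_idx [simp]: "of_idx (to_idx x) = x" and to_of_idx [simp]: "to_idx (of_idx y) = y"
  by (simp_all add: of_idx_def to_idx_def vec_eq_iff Rep_idx_inverse)

lemma linear_to_idx: "linear (to_idx :: real ^ 'n::finite \<Rightarrow> _)"
  and linear_of_idx: "linear (of_idx :: _ \<Rightarrow> real ^ 'n::finite)"
  by (auto intro!: linearI simp: of_idx_def to_idx_def vec_eq_iff)

lemma inner_to_idx: "to_idx x \<bullet> to_idx y = x \<bullet> (y :: real ^ 'n::finite)"
  unfolding inner_vec_def to_idx_def using sum_idx[of "\<lambda>i. x $ i \<bullet> y $ i"] by simp

lemma inner_of_idx: "of_idx x \<bullet> of_idx y = x \<bullet> (y :: real ^ 'n::finite idx)"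
  by (metis inner_to_idx to_of_idx)

lemma Basis_vec_eq_range_axis: "(Basis :: (real ^ 'n::finite) set) = range (\<lambda>i. axis i 1)"
  by (auto simp: Basis_vec_def)

lemma prod_Basis_vec: "(\<Prod>b\<in>Basis. x \<bullet> b) = (\<Prod>i\<in>UNIV. (x :: real ^ 'n::finite) $ i)"
  unfolding Basis_vec_eq_range_axis
  by (subst prod.reindex) (auto simp: inj_on_def axis_eq_axis inner_axis)

text \<open>
  Relabelling coordinates maps boxes to boxes with the same side lengths.
\<close>

lemma distr_of_idx: "distr lborel borel of_idx = (lborel :: (real ^ 'n::finite) measure)"
proof (rule lborel_eqI[symmetric])
  fix l u :: "real ^ 'n"
  assume le: "\<And>b. b \<in> Basis \<Longrightarrow> l \<bullet> b \<le> u \<bullet> b"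
  then have lu: "l $ i \<le> u $ i" for i
    by (metis axis_in_Basis_iff insertI1 inner_axis inner_real_def mult.right_neutral Basis_real_def)
  have m: "(of_idx :: _ \<Rightarrow> real ^ 'n) \<in> borel_measurable borel"
    by (intro borel_measurable_continuous_onI linear_continuous_on linear_conv_bounded_linear[THEN iffD1] linear_of_idx)
  have "of_idx -` box l u = box (to_idx l) (to_idx u)"
    apply (auto simp: mem_box_cart of_idx_def to_idx_def)
       apply (metis Rep_idx_inverse)
      apply (metis Rep_idx_inverse)
     apply (metis Abs_idx_inv)
    apply (metis Abs_idx_inv)
    done
  then have "emeasure (distr lborel borel of_idx) (box l u) = emeasure lborel (box (to_idx l) (to_idx u))"
    using m by (simp add: emeasure_distr)
  also have "\<dots> = ennreal (\<Prod>b\<in>Basis. (to_idx u - to_idx l) \<bullet> b)"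
    using lu by (intro emeasure_lborel_box) (auto simp: Basis_vec_eq_range_axis inner_axis to_idx_def)
  also have "(\<Prod>b\<in>Basis. (to_idx u - to_idx l) \<bullet> b) = (\<Prod>b\<in>Basis. (u - l) \<bullet> b)"
    unfolding prod_Basis_vec to_idx_def
    using prod.reindex_bij_betw[OF bij_Rep_idx, of "\<lambda>i. (u - l) $ i"] by simp
  finally show "emeasure (distr lborel borel of_idx) (box l u) = ennreal (\<Prod>b\<in>Basis. (u - l) \<bullet> b)" .
qed simp

lemma to_idx_image: "to_idx ` S = of_idx -` S"
  by (auto simp: image_iff) (metis to_of_idx)

lemma emeasure_to_idx:
  fixes S :: "(real ^ 'n::finite) set"
  assumes "S \<in> sets borel"
  shows "to_idx ` S \<in> sets borel" "emeasure lborel (to_idx ` S) = emeasure lborel S"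
proof -
  have m: "(of_idx :: _ \<Rightarrow> real ^ 'n) \<in> borel_measurable borel"
    by (intro borel_measurable_continuous_onI linear_continuous_on linear_conv_bounded_linear[THEN iffD1] linear_of_idx)
  show "to_idx ` S \<in> sets borel"
    using measurable_sets[OF m assms] by (simp add: to_idx_image)
  have "emeasure lborel S = emeasure (distr lborel borel of_idx) S"
    by (simp add: distr_of_idx)
  then show "emeasure lborel (to_idx ` S) = emeasure lborel S"
    using m assms by (simp add: emeasure_distr to_idx_image)
qed

text \<open>
  Stated with the determinant of the relabelled map, since the maps used below are relabelled to maps
  of the same kind.
\<close>

lemma measure_linear_image_idx:
  fixes f :: "real ^ 'n::finite \<Rightarrow> real ^ 'n"
  assumes f: "linear f" and S: "S \<in> fmeasurable lborel" and fS: "f ` S \<in> sets borel"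
  shows "f ` S \<in> fmeasurable lborel"
    and "measure lborel (f ` S) = \<bar>det (matrix (to_idx \<circ> f \<circ> of_idx))\<bar> * measure lborel S"
proof -
  let ?g = "to_idx \<circ> f \<circ> of_idx"
  have g: "linear ?g"
    using f linear_to_idx linear_of_idx by (intro linear_compose)
  have S': "to_idx ` S \<in> fmeasurable lborel"
    using S emeasure_to_idx[of S] by (auto simp: fmeasurable_def)
  then have "to_idx ` S \<in> lmeasurable"
    by (auto simp: fmeasurable_def)
  note L = measurable_linear_image[OF g this] measure_linear_image[OF g this]
  have eq: "?g ` to_idx ` S = to_idx ` f ` S"
    by (simp add: image_comp o_def)
  note b = emeasure_to_idx[OF fS]
  have "emeasure lborel (f ` S) < \<infinity>"
    using L(1) b unfolding eq by (auto simp: fmeasurable_def)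
  then show "f ` S \<in> fmeasurable lborel"
    using fS by (auto simp: fmeasurable_def)
  show "measure lborel (f ` S) = \<bar>det (matrix ?g)\<bar> * measure lborel S"
    using L(2) b emeasure_to_idx[of S] S S' unfolding eq by (auto simp: measure_def fmeasurable_def)
qed

text \<open>
  Rotation invariance, obtained by applying the previous lemma to preimages of boxes.
\<close>

lemma distr_orthogonal_transformation:
  fixes f :: "real ^ 'n::finite \<Rightarrow> real ^ 'n"
  assumes f: "orthogonal_transformation f"
  shows "distr lborel borel f = lborel"
proof (rule lborel_eqI[symmetric])
  fix l u :: "real ^ 'n"
  assume le: "\<And>b. b \<in> Basis \<Longrightarrow> l \<bullet> b \<le> u \<bullet> b"
  have m: "f \<in> borel_measurable borel"
    by (intro borel_measurable_continuous_onI linear_continuous_on linear_conv_bounded_linear[THEN iffD1]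
         orthogonal_transformation_linear f)
  let ?h = "inv f"
  have h: "orthogonal_transformation ?h"
    using f by (rule orthogonal_transformation_inv)
  have im: "?h ` box l u = f -` box l u"
    by (metis bij_vimage_eq_inv_image f orthogonal_transformation_bij)
  have b: "?h ` box l u \<in> sets borel"
    unfolding im using measurable_sets[OF m, of "box l u"] by simp
  have "orthogonal_transformation (to_idx \<circ> ?h \<circ> of_idx)"
    using h linear_compose[OF linear_of_idx linear_compose[OF _ linear_to_idx]]
    unfolding orthogonal_transformation_def by (auto simp: inner_to_idx inner_of_idx o_assoc)
  then have d: "\<bar>det (matrix (to_idx \<circ> ?h \<circ> of_idx))\<bar> = 1"
    by simp
  note L = measure_linear_image_idx[OF orthogonal_transformation_linear[OF h] fmeasurable_box b, unfolded d]
  have "emeasure (distr lborel borel f) (box l u) = emeasure lborel (?h ` box l u)"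
    using m by (simp add: emeasure_distr im)
  also have "\<dots> = emeasure lborel (box l u)"
    using L(2) fmeasurableD2[OF L(1)] fmeasurableD2[OF fmeasurable_box, of l u]
    by (simp add: emeasure_eq_ennreal_measure)
  finally show "emeasure (distr lborel borel f) (box l u) = ennreal (\<Prod>b\<in>Basis. (u - l) \<bullet> b)"
    using le by simp
qed simp

lemma scaleR_axis: "c *\<^sub>R axis k x = axis k (c *\<^sub>R x)"
  by (simp add: vec_eq_iff axis_def)

lemma det_rank_one_update_axis:
  fixes w :: "real ^ 'n::finite"
  shows "det (matrix (\<lambda>y. y + (w \<bullet> y) *\<^sub>R axis k 1)) = 1 + w $ k"
proof -
  have "det (matrix (\<lambda>y. y + (w \<bullet> y) *\<^sub>R axis k 1))
      = det (transpose (matrix (\<lambda>y. y + (w \<bullet> y) *\<^sub>R axis k 1)))"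
    by simp
  also have "transpose (matrix (\<lambda>y. y + (w \<bullet> y) *\<^sub>R axis k 1))
      = (\<chi> i j. if j = k then (mat 1 *v (axis k 1 + w)) $ i else mat 1 $ i $ j)"
    by (simp add: vec_eq_iff transpose_def matrix_def inner_axis) (auto simp: mat_def axis_def)
  also have "det \<dots> = 1 + w $ k"
    by (subst cramer_lemma) (simp add: axis_def)
  finally show ?thesis .
qed

text \<open>
  An orthogonal change of coordinates that makes $v$ a multiple of a basis vector reduces the
  statement to the update of a single row.
\<close>

lemma det_rank_one_update:
  fixes v w :: "real ^ 'n::finite"
  shows "det (matrix (\<lambda>y. y + (w \<bullet> y) *\<^sub>R v)) = 1 + w \<bullet> v"
proof (cases "v = 0")
  case True
  then show ?thesis by (simp add: matrix_id_mat_1 flip: id_def)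
next
  case False
  fix k :: 'n
  obtain q :: "real ^ 'n \<Rightarrow> real ^ 'n" where q: "orthogonal_transformation q" "q (axis k (norm v)) = v"
    by (rule orthogonal_transformation_exists[of "axis k (norm v)" v])
       (auto simp: norm_eq_sqrt_inner inner_axis_axis)
  let ?f = "\<lambda>y. y + (w \<bullet> y) *\<^sub>R v"
  let ?w = "norm v *\<^sub>R inv q w"
  let ?h = "\<lambda>y. y + (?w \<bullet> y) *\<^sub>R axis k 1"
  have lq: "linear q" "linear (inv q)"
    using q orthogonal_transformation_inv by (auto intro: orthogonal_transformation_linear)
  have inv: "q (inv q y) = y" "inv q (q y) = y" for y
    using orthogonal_transformation_surj[OF q(1)] orthogonal_transformation_inj[OF q(1)]
    by (auto simp: surj_f_inv_f)
  have iq: "inv q x \<bullet> y = x \<bullet> q y" for x y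
    using q(1) inv by (metis orthogonal_transformation_def)
  have qk: "norm v *\<^sub>R q (axis k 1) = v"
    using q(2) linear_cmul[OF lq(1), of "norm v" "axis k 1"]
    by (simp add: scaleR_axis)
  have lh: "linear ?h"
    by (intro linearI) (auto simp: inner_add_right algebra_simps)
  have "?f \<circ> q = q \<circ> ?h"
  proof
    fix y
    have "q ((?w \<bullet> y) *\<^sub>R axis k 1) = (w \<bullet> q y) *\<^sub>R (norm v *\<^sub>R q (axis k 1))"
      by (simp add: linear_cmul[OF lq(1)] iq)
    then show "(?f \<circ> q) y = (q \<circ> ?h) y"
      using qk by (simp add: linear_add[OF lq(1)])
  qed
  moreover have lf: "linear ?f"
    by (intro linearI) (auto simp: inner_add_right algebra_simps)
  ultimately have "matrix ?f ** matrix q = matrix q ** matrix ?h"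
    using matrix_compose[OF lq(1) lf] matrix_compose[OF lh lq(1)] by simp
  from arg_cong[OF this, of det]
  have "det (matrix ?f) * det (matrix q) = det (matrix q) * det (matrix ?h)"
    unfolding det_mul .
  moreover have "det (matrix q) \<noteq> 0"
    using orthogonal_transformation_det[OF q(1)] by force
  ultimately have "det (matrix ?f) = det (matrix ?h)"
    by (simp add: mult.commute[of "det (matrix ?f)"])
  also have "\<dots> = 1 + ?w $ k"
    by (rule det_rank_one_update_axis)
  also have "?w $ k = ?w \<bullet> axis k 1"
    by (simp add: inner_axis)
  also have "\<dots> = w \<bullet> v"
    unfolding inner_scaleR_left iq by (subst (2) qk[symmetric]) (simp only: inner_scaleR_right)
  finally show ?thesis .
qed

lemma measure_rank_one_update:
  fixes v w :: "real ^ 'n::finite"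
  defines "f \<equiv> \<lambda>y. y + (w \<bullet> y) *\<^sub>R v"
  assumes "compact S"
  shows "measure lborel (f ` S) = \<bar>1 + w \<bullet> v\<bar> * measure lborel S"
proof -
  have lf: "linear f"
    unfolding f_def by (intro linearI) (auto simp: inner_add_right algebra_simps)
  have fS: "f ` S \<in> sets borel"
    using assms(2) lf by (intro borel_compact compact_continuous_image linear_continuous_on linear_conv_bounded_linear[THEN iffD1])
  have S: "S \<in> fmeasurable lborel"
    using assms(2) by (rule fmeasurable_compact)
  have "to_idx \<circ> f \<circ> of_idx = (\<lambda>y. y + (to_idx w \<bullet> y) *\<^sub>R to_idx v)"
  proof
    fix y
    have "to_idx w \<bullet> y = w \<bullet> of_idx y"
      by (metis inner_to_idx to_of_idx)
    then show "(to_idx \<circ> f \<circ> of_idx) y = y + (to_idx w \<bullet> y) *\<^sub>R to_idx v"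
      by (simp add: f_def linear_add[OF linear_to_idx] linear_cmul[OF linear_to_idx])
  qed
  then have d: "det (matrix (to_idx \<circ> f \<circ> of_idx)) = 1 + w \<bullet> v"
    by (simp only: det_rank_one_update inner_to_idx)
  show ?thesis
    using measure_linear_image_idx(2)[OF lf S fS] unfolding d .
qed

section \<open>Lebesgue measure in orthonormal coordinates\<close>

lemma orthonormal_basis_ofD:
  assumes "orthonormal_basis_of V B"
  shows "finite B" "independent B" "span B = V"
    "\<And>b c. b \<in> B \<Longrightarrow> c \<in> B \<Longrightarrow> b \<bullet> c = (if b = c then 1 else 0)"
proof -
  have B: "pairwise orthogonal B" "\<And>b. b \<in> B \<Longrightarrow> norm b = 1" "span B = V"
    using assms by (auto simp: orthonormal_basis_of_def)
  show "independent B"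
    using B(1,2) by (intro pairwise_orthogonal_independent) (force dest: B(2))+
  then show "finite B" by (rule independent_imp_finite)
  show "span B = V" by fact
  show "b \<bullet> c = (if b = c then 1 else 0)" if "b \<in> B" "c \<in> B" for b c
    using that B by (auto simp: pairwise_def orthogonal_def dot_square_norm)
qed

text \<open>
  Lebesgue measure is defined by the standard basis; rotation invariance transfers the product
  representation to any orthonormal basis.
\<close>

lemma lborel_orthonormal_basis:
  fixes B :: "(real ^ 'n::finite) set"
  assumes B: "orthonormal_basis_of UNIV B"
  shows "lborel = distr (\<Pi>\<^sub>M b\<in>B. lborel) borel (\<lambda>c. \<Sum>b\<in>B. c b *\<^sub>R b)"
proof -
  note B' = orthonormal_basis_ofD[OF B]
  interpret product_sigma_finite "\<lambda>_. lborel :: real measure" ..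
  have card: "card (Basis :: (real ^ 'n) set) = card B"
    using B'(2,3) by (metis dim_UNIV dim_eq_card_independent dim_span)
  obtain h where h: "bij_betw h (Basis :: (real ^ 'n) set) B"
    using card B'(1) by (metis finite_Basis finite_same_card_bij)
  have hB: "h i \<in> B" if "i \<in> Basis" for i
    using h that by (auto simp: bij_betw_def)
  have hinj: "h i = h j \<longleftrightarrow> i = j" if "i \<in> Basis" "j \<in> Basis" for i j
    using h that by (auto simp: bij_betw_def inj_on_def)
  define f where "f x = (\<Sum>i\<in>Basis. (x \<bullet> i) *\<^sub>R h i)" for x :: "real ^ 'n"
  have "linear f"
    unfolding f_def by (intro linearI) (auto simp: inner_add_left scaleR_add_left sum.distrib scaleR_sum_right)
  moreover have "f x \<bullet> f y = x \<bullet> y" for x y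
  proof -
    have "f x \<bullet> f y = (\<Sum>i\<in>Basis. \<Sum>j\<in>Basis. (x \<bullet> i) * (y \<bullet> j) * (h i \<bullet> h j))"
      unfolding f_def inner_sum_left inner_sum_right
      by (subst sum.swap) (simp add: mult_ac)
    also have "\<dots> = (\<Sum>i\<in>Basis. \<Sum>j\<in>Basis. if i = j then (x \<bullet> i) * (y \<bullet> j) else 0)"
      using hB hinj B'(4) by (intro sum.cong refl) auto
    also have "\<dots> = x \<bullet> y"
      by (simp add: euclidean_inner[of x y])
    finally show ?thesis .
  qed
  ultimately have f: "orthogonal_transformation f"
    by (simp add: orthogonal_transformation_def)
  have mf: "f \<in> borel_measurable borel"
    using \<open>linear f\<close> by (intro borel_measurable_continuous_onI linear_continuous_on linear_conv_bounded_linear[THEN iffD1])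
  let ?g = "\<lambda>c. \<lambda>i\<in>Basis. c (h i)"
  have g: "?g \<in> (\<Pi>\<^sub>M b\<in>B. lborel :: real measure) \<rightarrow>\<^sub>M (\<Pi>\<^sub>M b\<in>Basis. lborel)"
    using hB by (intro measurable_restrict measurable_component_singleton) auto
  have re: "distr (\<Pi>\<^sub>M b\<in>B. lborel) (\<Pi>\<^sub>M b\<in>Basis. lborel) ?g = (\<Pi>\<^sub>M b\<in>Basis. lborel :: real measure)"
  proof (rule PiM_eqI)
    fix A :: "real ^ 'n \<Rightarrow> real set"
    assume A: "\<And>i. i \<in> Basis \<Longrightarrow> A i \<in> sets lborel"
    define h' where "h' = the_inv_into Basis h"
    have h': "h' (h i) = i" if "i \<in> Basis" for i
      using h that by (simp add: h'_def bij_betw_def the_inv_into_f_f)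
    have hh': "h (h' b) = b" "h' b \<in> Basis" if "b \<in> B" for b
      using h that h' by (auto simp: bij_betw_def)
    have "?g -` Pi\<^sub>E Basis A \<inter> space (\<Pi>\<^sub>M b\<in>B. lborel) = (\<Pi>\<^sub>E b\<in>B. A (h' b))"
    proof (intro set_eqI iffI)
      fix c assume "c \<in> ?g -` Pi\<^sub>E Basis A \<inter> space (\<Pi>\<^sub>M b\<in>B. lborel)"
      then have c: "\<And>i. i \<in> Basis \<Longrightarrow> c (h i) \<in> A i" "c \<in> extensional B"
        by (auto simp: space_PiM PiE_iff)
      have "c b \<in> A (h' b)" if "b \<in> B" for b
        using c(1)[of "h' b"] hh'[OF that] by simp
      with c(2) show "c \<in> (\<Pi>\<^sub>E b\<in>B. A (h' b))"
        by (simp add: PiE_iff)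
    next
      fix c assume c: "c \<in> (\<Pi>\<^sub>E b\<in>B. A (h' b))"
      have "c (h i) \<in> A i" if "i \<in> Basis" for i
        using c hB[OF that] h'[OF that] by (auto simp: PiE_iff)
      with c show "c \<in> ?g -` Pi\<^sub>E Basis A \<inter> space (\<Pi>\<^sub>M b\<in>B. lborel)"
        by (simp add: space_PiM PiE_iff)
    qed
    then have "emeasure (distr (\<Pi>\<^sub>M b\<in>B. lborel) (\<Pi>\<^sub>M b\<in>Basis. lborel) ?g) (Pi\<^sub>E Basis A)
        = emeasure (\<Pi>\<^sub>M b\<in>B. lborel) (\<Pi>\<^sub>E b\<in>B. A (h' b))"
      using A g by (subst emeasure_distr) (auto intro!: sets_PiM_I_finite)
    also have "\<dots> = (\<Prod>b\<in>B. emeasure lborel (A (h' b)))"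
      using A hh' B'(1) by (intro emeasure_PiM) auto
    also have "\<dots> = (\<Prod>i\<in>Basis. emeasure lborel (A i))"
      using prod.reindex_bij_betw[OF h, of "\<lambda>b. emeasure lborel (A (h' b))"] h' by simp
    finally show "emeasure (distr (\<Pi>\<^sub>M b\<in>B. lborel) (\<Pi>\<^sub>M b\<in>Basis. lborel) ?g) (Pi\<^sub>E Basis A)
        = (\<Prod>i\<in>Basis. emeasure lborel (A i))" .
  qed auto
  have ms: "(\<lambda>c. \<Sum>b\<in>Basis. c b *\<^sub>R b) \<in> (\<Pi>\<^sub>M b\<in>Basis. lborel) \<rightarrow>\<^sub>M (borel :: (real ^ 'n) measure)"
    by measurable
  have "lborel = distr (lborel :: (real ^ 'n) measure) borel f"
    by (simp add: distr_orthogonal_transformation[OF f])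
  also have "\<dots> = distr (distr (\<Pi>\<^sub>M b\<in>Basis. lborel) borel (\<lambda>c. \<Sum>b\<in>Basis. c b *\<^sub>R b)) borel f"
    by (simp only: lborel_eq[where 'a="real ^ 'n"])
  also have "\<dots> = distr (\<Pi>\<^sub>M b\<in>Basis. lborel) borel (f \<circ> (\<lambda>c. \<Sum>b\<in>Basis. c b *\<^sub>R b))"
    using mf ms by (rule distr_distr)
  also have "\<dots> = distr (distr (\<Pi>\<^sub>M b\<in>B. lborel) (\<Pi>\<^sub>M b\<in>Basis. lborel) ?g) borel (f \<circ> (\<lambda>c. \<Sum>b\<in>Basis. c b *\<^sub>R b))"
    by (simp only: re)
  also have "\<dots> = distr (\<Pi>\<^sub>M b\<in>B. lborel) borel ((f \<circ> (\<lambda>c. \<Sum>b\<in>Basis. c b *\<^sub>R b)) \<circ> ?g)"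
    using g mf ms by (intro distr_distr measurable_comp[OF ms mf])
  also have "(f \<circ> (\<lambda>c. \<Sum>b\<in>Basis. c b *\<^sub>R b)) \<circ> ?g = (\<lambda>c. \<Sum>b\<in>B. c b *\<^sub>R b)"
  proof
    fix c :: "real ^ 'n \<Rightarrow> real"
    have "((f \<circ> (\<lambda>c. \<Sum>b\<in>Basis. c b *\<^sub>R b)) \<circ> ?g) c = (\<Sum>i\<in>Basis. c (h i) *\<^sub>R h i)"
      by (simp add: f_def cong: sum.cong)
    also have "\<dots> = (\<Sum>b\<in>B. c b *\<^sub>R b)"
      using sum.reindex_bij_betw[OF h, of "\<lambda>b. c b *\<^sub>R b"] by simp
    finally show "((f \<circ> (\<lambda>c. \<Sum>b\<in>Basis. c b *\<^sub>R b)) \<circ> ?g) c = (\<Sum>b\<in>B. c b *\<^sub>R b)" .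
  qed
  finally show ?thesis .
qed

lemma emeasure_lborel_affine_vimage:
  fixes r m :: real
  assumes "r > 0" and A: "A \<in> sets borel"
  shows "emeasure lborel {x. m + r * x \<in> A} = ennreal (1 / r) * emeasure lborel A"
proof -
  have m': "(\<lambda>x. m + r * x) \<in> borel_measurable borel" by measurable
  have "emeasure lborel A = emeasure (density (distr lborel borel (\<lambda>x. m + r * x)) (\<lambda>_. ennreal \<bar>r\<bar>)) A"
    using lborel_real_affine[of r m] assms(1) by simp
  also have "\<dots> = ennreal r * emeasure lborel {x. m + r * x \<in> A}"
    using assms m' by (subst emeasure_density)
      (auto simp: nn_integral_cmult_indicator emeasure_distr vimage_def)
  finally show ?thesis
    using assms(1) by (simp add: mult.assoc[symmetric] ennreal_mult[symmetric])
qed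

text \<open>
  Used to compare parallel slices of a cone, whose coordinates differ by a translation and a
  dilation.
\<close>

lemma PiM_lborel_affine:
  fixes r :: real and m :: "'i \<Rightarrow> real"
  assumes I: "finite I" and r: "r > 0" and E: "E \<in> sets (\<Pi>\<^sub>M i\<in>I. (lborel :: real measure))"
  shows "emeasure (\<Pi>\<^sub>M i\<in>I. lborel) {c \<in> space (\<Pi>\<^sub>M i\<in>I. lborel). (\<lambda>i\<in>I. m i + r * c i) \<in> E}
      = ennreal ((1 / r) ^ card I) * emeasure (\<Pi>\<^sub>M i\<in>I. lborel) E"
proof -
  interpret product_sigma_finite "\<lambda>_. lborel :: real measure" ..
  let ?P = "\<Pi>\<^sub>M i\<in>I. (lborel :: real measure)"
  let ?g = "\<lambda>c. \<lambda>i\<in>I. m i + r * c i"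
  have g: "?g \<in> ?P \<rightarrow>\<^sub>M ?P" by measurable
  have "scale_measure (ennreal (r ^ card I)) (distr ?P ?P ?g) = ?P"
  proof (rule PiM_eqI)
    fix A :: "'i \<Rightarrow> real set" assume A: "\<And>i. i \<in> I \<Longrightarrow> A i \<in> sets lborel"
    have s: "{x. m i + r * x \<in> A i} \<in> sets lborel" if "i \<in> I" for i
    proof -
      have "(\<lambda>x. m i + r * x) \<in> borel_measurable borel" by measurable
      from measurable_sets[OF this, of "A i"] A[OF that] show ?thesis
        by (simp add: vimage_def)
    qed
    have "?g -` Pi\<^sub>E I A \<inter> space ?P = (\<Pi>\<^sub>E i\<in>I. {x. m i + r * x \<in> A i})"
      by (auto simp: space_PiM PiE_iff)
    then have "emeasure (distr ?P ?P ?g) (Pi\<^sub>E I A) = emeasure ?P (\<Pi>\<^sub>E i\<in>I. {x. m i + r * x \<in> A i})"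
      using g A I by (subst emeasure_distr) (auto intro!: sets_PiM_I_finite)
    also have "\<dots> = (\<Prod>i\<in>I. emeasure lborel {x. m i + r * x \<in> A i})"
      using s I by (intro emeasure_PiM) auto
    also have "\<dots> = (\<Prod>i\<in>I. ennreal (1 / r) * emeasure lborel (A i))"
      using A r by (intro prod.cong refl emeasure_lborel_affine_vimage) auto
    also have "\<dots> = ennreal (1 / r) ^ card I * (\<Prod>i\<in>I. emeasure lborel (A i))"
      by (simp add: prod.distrib)
    finally have "ennreal (r ^ card I) * emeasure (distr ?P ?P ?g) (Pi\<^sub>E I A)
        = (ennreal (r ^ card I) * ennreal (1 / r) ^ card I) * (\<Prod>i\<in>I. emeasure lborel (A i))"
      by (simp add: mult.assoc)
    also have "ennreal (r ^ card I) * ennreal (1 / r) ^ card I = 1"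
      using r by (simp add: ennreal_power ennreal_mult[symmetric] power_mult_distrib[symmetric])
    finally show "emeasure (scale_measure (ennreal (r ^ card I)) (distr ?P ?P ?g)) (Pi\<^sub>E I A)
        = (\<Prod>i\<in>I. emeasure lborel (A i))"
      by (simp only: emeasure_scale_measure mult_1)
  qed (use I in auto)
  then have "emeasure ?P E = ennreal (r ^ card I) * emeasure (distr ?P ?P ?g) E"
    using emeasure_scale_measure[of "ennreal (r ^ card I)" "distr ?P ?P ?g" E] by simp
  also have "emeasure (distr ?P ?P ?g) E = emeasure ?P {c \<in> space ?P. ?g c \<in> E}"
    using g E by (subst emeasure_distr) (auto intro!: arg_cong[where f="emeasure ?P"])
  finally have "ennreal ((1 / r) ^ card I) * emeasure ?P E
      = (ennreal ((1 / r) ^ card I) * ennreal (r ^ card I)) * emeasure ?P {c \<in> space ?P. ?g c \<in> E}"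
    by (simp add: mult.assoc)
  also have "ennreal ((1 / r) ^ card I) * ennreal (r ^ card I) = 1"
    using r by (simp add: ennreal_mult[symmetric] power_mult_distrib[symmetric])
  finally show ?thesis by (simp only: mult_1_left)
qed

section \<open>From sections to prisms over cones\<close>

text \<open>
  The vector $y - \langle a, y \rangle a$ is the orthogonal projection to the hyperplane, and it
  has the same coordinate sum as $y$ when the coordinate sum of $a$ is $0$.
\<close>

definition cone_prism :: "real ^ 'n \<Rightarrow> (real ^ 'n) set" where
  "cone_prism a = {y. (\<forall>j. (y - (a \<bullet> y) *\<^sub>R a) $ j \<ge> 0) \<and> (\<Sum>j\<in>UNIV. y $ j) \<le> 1 \<and> 0 \<le> a \<bullet> y \<and> a \<bullet> y \<le> 1}"

text \<open>
  The volume of a cone of dimension $N - 1$ that is cut off at height $1$, where its slice has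
  volume $1$. Here $t$ is the distance to the apex along the diagonal, which corresponds to the
  height $\sqrt N t$ in terms of the coordinate sum.
\<close>

definition slice_integral :: "nat \<Rightarrow> ennreal" where
  "slice_integral N = (\<integral>\<^sup>+t\<in>{0..1 / sqrt N}. ennreal ((sqrt N * t) ^ (N - 2)) \<partial>lborel)"

lemma closed_cone_prism: "closed (cone_prism (a :: real ^ 'n::finite))"
  unfolding cone_prism_def
  by (intro closed_Collect_conj closed_Collect_all closed_Collect_le continuous_intros)

text \<open>
  This unpacks the arbitrary choices of base point and basis in the definition of the section
  volume; the rest of the argument works for any such choice.
\<close>

lemma section_vol_orthonormal_coordinates:
  fixes a :: "real ^ 'n::finite"
  defines "V \<equiv> {x :: real ^ 'n. a \<bullet> x = 0 \<and> (\<Sum>j\<in>UNIV. x $ j) = 0}"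
  assumes a: "(\<Sum>j\<in>UNIV. a $ j) = 0"
  obtains p B where "a \<bullet> p = 0" "(\<Sum>j\<in>UNIV. p $ j) = 1" "orthonormal_basis_of V B"
    "section_vol a = emeasure (\<Pi>\<^sub>M b\<in>B. lborel)
       {c \<in> space (\<Pi>\<^sub>M b\<in>B. lborel). \<forall>j. (p + (\<Sum>b\<in>B. c b *\<^sub>R b)) $ j \<ge> 0}"
proof -
  let ?A = "hyperplane0 a \<inter> {x. (\<Sum>j\<in>UNIV. x $ j) = 1}"
  have "(\<chi> j. 1 / real CARD('n)) \<in> ?A"
    using a by (auto simp: hyperplane0_def inner_vec_def sum_divide_distrib[symmetric])
  then have p: "(SOME p. p \<in> ?A) \<in> ?A" by (rule someI)
  define p where "p = (SOME p. p \<in> ?A)"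
  have pA: "a \<bullet> p = 0" "(\<Sum>j\<in>UNIV. p $ j) = 1"
    using p unfolding p_def[symmetric] by (auto simp: hyperplane0_def)
  have V: "(\<lambda>x. x - p) ` ?A = V"
  proof (intro set_eqI iffI)
    fix x assume "x \<in> V"
    then show "x \<in> (\<lambda>x. x - p) ` ?A"
      using pA by (intro image_eqI[of _ _ "x + p"]) (auto simp: V_def hyperplane0_def inner_add_right sum.distrib)
  next
    fix x assume "x \<in> (\<lambda>x. x - p) ` ?A"
    then obtain y where y: "x = y - p" "a \<bullet> y = 0" "(\<Sum>j\<in>UNIV. y $ j) = 1"
      by (auto simp: hyperplane0_def)
    then show "x \<in> V"
      using pA by (simp add: V_def inner_diff_right sum_subtractf)
  qed
  have "subspace V"
    unfolding V_def subspace_def by (auto simp: inner_add_right sum.distrib sum_distrib_left[symmetric])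
  then obtain B0 where "pairwise orthogonal B0" "\<And>x. x \<in> B0 \<Longrightarrow> norm x = 1" "span B0 = V"
    by (rule orthonormal_basis_subspace) metis
  then have "orthonormal_basis_of V B0"
    by (simp add: orthonormal_basis_of_def)
  then have "orthonormal_basis_of V (SOME B. orthonormal_basis_of V B)"
    by (rule someI)
  moreover define B where "B = (SOME B. orthonormal_basis_of V B)"
  ultimately have B: "orthonormal_basis_of V B" by simp
  note B' = orthonormal_basis_ofD[OF B]
  let ?P = "\<Pi>\<^sub>M b\<in>B. (lborel :: real measure)"
  let ?g = "\<lambda>c. p + (\<Sum>b\<in>B. c b *\<^sub>R b)"
  let ?K = "hyperplane0 a \<inter> regular_simplex"
  have g: "?g \<in> ?P \<rightarrow>\<^sub>M borel" by measurable
  have "closed ?K"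
    unfolding hyperplane0_def regular_simplex_def
    by (intro closed_Int closed_Collect_conj closed_Collect_all closed_Collect_le closed_Collect_eq continuous_intros)
  then have K: "?K \<in> sets borel" by (rule borel_closed)
  have gA: "a \<bullet> ?g c = 0 \<and> (\<Sum>j\<in>UNIV. ?g c $ j) = 1" for c
  proof -
    have "(\<Sum>b\<in>B. c b *\<^sub>R b) \<in> V"
      unfolding B'(3)[symmetric] by (intro span_sum span_scale span_base)
    then show ?thesis
      using pA by (simp add: V_def inner_add_right sum.distrib del: sum_component)
  qed
  have "section_vol a = emeasure (completion (distr ?P borel ?g)) ?K"
    unfolding section_vol_def affine_lebesgue_def Let_def p_def[symmetric] V B_def[symmetric] ..
  also have "\<dots> = emeasure (distr ?P borel ?g) ?K"
    using K by simp
  also have "\<dots> = emeasure ?P (?g -` ?K \<inter> space ?P)"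
    using g K by (rule emeasure_distr)
  also have "?g -` ?K \<inter> space ?P = {c \<in> space ?P. \<forall>j. ?g c $ j \<ge> 0}"
  proof -
    have "y \<in> ?K \<longleftrightarrow> (\<forall>j. y $ j \<ge> 0)" if "a \<bullet> y = 0 \<and> (\<Sum>j\<in>UNIV. y $ j) = 1" for y
      using that by (auto simp: hyperplane0_def regular_simplex_def)
    from this[OF gA] show ?thesis by blast
  qed
  finally show ?thesis
    by (rule that[OF pA B])
qed

lemma orthonormal_expansion:
  assumes B: "orthonormal_basis_of V B" and "x \<in> V"
  shows "x = (\<Sum>b\<in>B. (x \<bullet> b) *\<^sub>R b)"
proof -
  note B' = orthonormal_basis_ofD[OF B]
  define d where "d = x - (\<Sum>b\<in>B. (x \<bullet> b) *\<^sub>R b)"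
  have "d \<in> span B"
    using assms(2) unfolding d_def B'(3)[symmetric]
    by (intro span_diff span_sum span_scale) (auto intro: span_base)
  moreover have "orthogonal d c" if "c \<in> B" for c
  proof -
    have "(\<Sum>b\<in>B. (x \<bullet> b) * (b \<bullet> c)) = (\<Sum>b\<in>B. if b = c then x \<bullet> b else 0)"
      using that B'(4) by (intro sum.cong) auto
    then show ?thesis
      using that B'(1) by (simp add: d_def orthogonal_def inner_diff_left inner_sum_left)
  qed
  ultimately have "orthogonal d d"
    by (rule orthogonal_to_span)
  then have "d = 0"
    by (simp add: orthogonal_def)
  then show ?thesis
    unfolding d_def by simp
qed

text \<open>
  Fubini in the orthonormal basis consisting of $a$, the unit diagonal $u$, and a basis $B$ of the
  directions of the section. The coordinate along $a$ contributes a factor $1$, and the slice at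
  $u$-coordinate $t$ is a dilated copy of the section.
\<close>

lemma emeasure_cone_prism:
  fixes a :: "real ^ 'n::finite"
  assumes norm_a: "norm a = 1" and sum_a: "(\<Sum>j\<in>UNIV. a $ j) = 0"
  shows "emeasure lborel (cone_prism a) = slice_integral CARD('n) * section_vol a"
proof -
  define V where "V = {x :: real ^ 'n. a \<bullet> x = 0 \<and> (\<Sum>j\<in>UNIV. x $ j) = 0}"
  obtain p B where p: "a \<bullet> p = 0" "(\<Sum>j\<in>UNIV. p $ j) = 1" and B: "orthonormal_basis_of V B"
    and vol: "section_vol a = emeasure (\<Pi>\<^sub>M b\<in>B. lborel)
       {c \<in> space (\<Pi>\<^sub>M b\<in>B. lborel). \<forall>j. (p + (\<Sum>b\<in>B. c b *\<^sub>R b)) $ j \<ge> 0}"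
    by (rule section_vol_orthonormal_coordinates[OF sum_a, folded V_def])
  note B' = orthonormal_basis_ofD[OF B]
  interpret product_sigma_finite "\<lambda>_. lborel :: real measure" ..
  let ?N = "CARD('n)"
  define s where "s = sqrt (real ?N)"
  have s: "s > 0" "s * s = real ?N" by (auto simp: s_def)
  define u :: "real ^ 'n" where "u = (\<chi> j. 1 / s)"
  have u_inner: "u \<bullet> x = (\<Sum>j\<in>UNIV. x $ j) / s" for x
    by (simp add: u_def inner_vec_def sum_divide_distrib)
  have sum_u: "(\<Sum>j\<in>UNIV. u $ j) = s"
    using s by (simp add: u_def field_simps)
  have aa: "a \<bullet> a = 1" using norm_a by (simp add: dot_square_norm)
  have uu: "u \<bullet> u = 1" using s by (simp add: u_inner sum_u)
  have au: "a \<bullet> u = 0" using sum_a by (simp add: u_inner inner_commute[of a u])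
  have V: "x \<in> V \<longleftrightarrow> a \<bullet> x = 0 \<and> u \<bullet> x = 0" for x
    using s by (simp add: V_def u_inner)
  have BV: "b \<in> V" if "b \<in> B" for b
    using that B'(3) span_base by blast
  have notin: "u \<notin> B" "a \<notin> insert u B"
    using BV V uu aa au by force+
  let ?B' = "insert a (insert u B)"
  have basis: "orthonormal_basis_of UNIV ?B'"
    unfolding orthonormal_basis_of_def
  proof (intro conjI)
    show "pairwise orthogonal ?B'"
      using BV V au B by (auto simp: orthonormal_basis_of_def pairwise_insert orthogonal_def inner_commute)
    show "\<forall>b\<in>?B'. norm b = 1"
      using norm_a uu B by (auto simp: orthonormal_basis_of_def norm_eq_1)
    have "x \<in> span ?B'" for x
    proof -
      have "x - (a \<bullet> x) *\<^sub>R a - (u \<bullet> x) *\<^sub>R u \<in> V"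
        using aa uu au by (simp add: V inner_diff_right inner_commute)
      then have "x - (a \<bullet> x) *\<^sub>R a - (u \<bullet> x) *\<^sub>R u \<in> span ?B'"
        using B'(3) span_mono[of B ?B'] by blast
      then have "(x - (a \<bullet> x) *\<^sub>R a - (u \<bullet> x) *\<^sub>R u) + (a \<bullet> x) *\<^sub>R a + (u \<bullet> x) *\<^sub>R u \<in> span ?B'"
        by (rule span_add[OF span_add[OF _ span_scale[OF span_base]] span_scale[OF span_base]]) auto
      then show ?thesis by simp
    qed
    then show "span ?B' = UNIV" by auto
  qed
  have "card ?B' = ?N"
    using orthonormal_basis_ofD(2,3)[OF basis] by (metis dim_UNIV dim_eq_card_independent dim_span DIM_cart DIM_real mult.right_neutral)
  then have card: "card B = ?N - 2"
    using notin B'(1) by simp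
  let ?P = "\<Pi>\<^sub>M b\<in>B. (lborel :: real measure)"
  let ?v = "\<lambda>c. \<Sum>b\<in>B. c b *\<^sub>R b"
  have vV: "?v c \<in> V" for c
    unfolding B'(3)[symmetric] by (intro span_sum span_scale span_base)
  define E where "E = {c \<in> space ?P. \<forall>j. (p + ?v c) $ j \<ge> 0}"
  have E: "E \<in> sets ?P"
  proof -
    have "(\<lambda>c. p + ?v c) \<in> ?P \<rightarrow>\<^sub>M borel" by measurable
    moreover have "{x :: real ^ 'n. \<forall>j. x $ j \<ge> 0} \<in> sets borel"
      by (intro borel_closed closed_Collect_all closed_Collect_le continuous_intros)
    ultimately have "(\<lambda>c. p + ?v c) -` {x. \<forall>j. x $ j \<ge> 0} \<inter> space ?P \<in> sets ?P"
      by (rule measurable_sets)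
    then show ?thesis
      by (simp add: E_def vimage_def Int_def conj_commute)
  qed
  have volE: "section_vol a = emeasure ?P E"
    unfolding E_def by (rule vol)
  \<comment> \<open>The base point has diagonal coordinate $1/s$. So the slice at diagonal coordinate $t$ is
    the section dilated by $s t$, up to a translation inside the slice.\<close>
  have p_expand: "p = (1 / s) *\<^sub>R u + ?v (\<lambda>b. p \<bullet> b)"
  proof -
    have "p - (1 / s) *\<^sub>R u \<in> V"
      using p uu au s by (simp add: V inner_diff_right u_inner)
    then have "p - (1 / s) *\<^sub>R u = ?v (\<lambda>b. (p - (1 / s) *\<^sub>R u) \<bullet> b)"
      by (rule orthonormal_expansion[OF B])
    also have "\<dots> = ?v (\<lambda>b. p \<bullet> b)"
      using BV by (intro sum.cong refl) (simp add: V inner_diff_left)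
    finally show ?thesis by (simp add: algebra_simps)
  qed
  have slice: "emeasure ?P {c \<in> space ?P. \<forall>j. (t *\<^sub>R u + ?v c) $ j \<ge> 0}
      = ennreal ((s * t) ^ (?N - 2)) * section_vol a" if t: "t > 0" for t
  proof -
    define r where "r = 1 / (s * t)"
    have r: "r > 0" using s t by (simp add: r_def)
    have eq: "p + ?v (\<lambda>b\<in>B. - (p \<bullet> b) + r * c b) = r *\<^sub>R (t *\<^sub>R u + ?v c)" for c
    proof -
      have "?v (\<lambda>b\<in>B. - (p \<bullet> b) + r * c b) = ?v (\<lambda>b. - (p \<bullet> b) + r * c b)"
        by (intro sum.cong) auto
      also have "\<dots> = - ?v (\<lambda>b. p \<bullet> b) + r *\<^sub>R ?v c"
        by (simp only: scaleR_add_left sum.distrib scaleR_minus_left sum_negf scaleR_sum_right scaleR_scaleR)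
      finally have "p + ?v (\<lambda>b\<in>B. - (p \<bullet> b) + r * c b) = (1 / s) *\<^sub>R u + r *\<^sub>R ?v c"
        by (subst p_expand) simp
      then show ?thesis
        using s t by (simp add: r_def scaleR_add_right)
    qed
    have rz: "0 \<le> r * z \<longleftrightarrow> 0 \<le> z" for z
      using r by (simp add: zero_le_mult_iff)
    have "(\<lambda>b\<in>B. - (p \<bullet> b) + r * c b) \<in> E \<longleftrightarrow> (\<forall>j. (t *\<^sub>R u + ?v c) $ j \<ge> 0)" for c
    proof -
      have "(\<lambda>b\<in>B. - (p \<bullet> b) + r * c b) \<in> space ?P"
        by (simp add: space_PiM)
      then show ?thesis
        unfolding E_def mem_Collect_eq eq[of c] vector_scaleR_component[of r]
        by (simp only: real_scaleR_def rz simp_thms)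
    qed
    then have "{c \<in> space ?P. (\<lambda>b\<in>B. - (p \<bullet> b) + r * c b) \<in> E}
        = {c \<in> space ?P. \<forall>j. (t *\<^sub>R u + ?v c) $ j \<ge> 0}"
      by (simp only:)
    then show ?thesis
      using PiM_lborel_affine[OF B'(1) r E, of "\<lambda>b. - (p \<bullet> b)"] volE r
      by (simp add: card r_def)
  qed
  have slice_neg: "{c \<in> space ?P. \<forall>j. (t *\<^sub>R u + ?v c) $ j \<ge> 0} = {}" if "t < 0" for t
  proof -
    have "\<not> (\<forall>j. (t *\<^sub>R u + ?v c) $ j \<ge> 0)" for c
    proof
      assume "\<forall>j. (t *\<^sub>R u + ?v c) $ j \<ge> 0"
      then have "0 \<le> (\<Sum>j\<in>UNIV. (t *\<^sub>R u + ?v c) $ j)"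
        by (intro sum_nonneg) auto
      also have "\<dots> = t * s"
        using vV[of c] sum_u by (simp add: sum.distrib V_def sum_distrib_left[symmetric])
      finally show False
        using s that by (simp add: zero_le_mult_iff)
    qed
    then show ?thesis by auto
  qed
  let ?f = "\<lambda>c. \<Sum>b\<in>?B'. c b *\<^sub>R b"
  let ?ind = "\<lambda>c. indicator (cone_prism a) (?f c) :: ennreal"
  have prism[measurable]: "cone_prism a \<in> sets borel"
    by (rule borel_closed[OF closed_cone_prism])
  have ind: "?ind \<in> borel_measurable (\<Pi>\<^sub>M b\<in>?B'. lborel)" by measurable
  have "emeasure lborel (cone_prism a) = emeasure (distr (\<Pi>\<^sub>M b\<in>?B'. lborel) borel ?f) (cone_prism a)"
    using lborel_orthonormal_basis[OF basis] by metis
  also have "\<dots> = (\<integral>\<^sup>+x. ?ind x \<partial>(\<Pi>\<^sub>M b\<in>?B'. lborel))"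
  proof -
    have "?f \<in> (\<Pi>\<^sub>M b\<in>?B'. lborel) \<rightarrow>\<^sub>M borel" by measurable
    then have "(\<integral>\<^sup>+x. ?ind x \<partial>(\<Pi>\<^sub>M b\<in>?B'. lborel))
        = (\<integral>\<^sup>+y. indicator (cone_prism a) y \<partial>distr (\<Pi>\<^sub>M b\<in>?B'. lborel) borel ?f)"
      using prism by (subst nn_integral_distr) auto
    then show ?thesis
      using prism by (simp del: sum.insert)
  qed
  also have "\<dots> = (\<integral>\<^sup>+h. \<integral>\<^sup>+x. ?ind (x(a := h)) \<partial>(\<Pi>\<^sub>M b\<in>insert u B. lborel) \<partial>lborel)"
    using B'(1) by (rule product_nn_integral_insert_rev[OF finite.insertI notin(2) ind])
  also have "\<dots> = (\<integral>\<^sup>+h. \<integral>\<^sup>+t. \<integral>\<^sup>+c. ?ind ((c(u := t))(a := h)) \<partial>?P \<partial>lborel \<partial>lborel)"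
  proof (intro nn_integral_cong)
    fix h :: real
    have "(\<lambda>x. x(a := h)) \<in> (\<Pi>\<^sub>M b\<in>insert u B. lborel) \<rightarrow>\<^sub>M (\<Pi>\<^sub>M b\<in>?B'. lborel)"
      by (intro measurable_fun_upd[where J="insert u B"]) auto
    then have ind': "(\<lambda>x. ?ind (x(a := h))) \<in> borel_measurable (\<Pi>\<^sub>M b\<in>insert u B. lborel)"
      using ind by (rule measurable_compose)
    show "(\<integral>\<^sup>+x. ?ind (x(a := h)) \<partial>(\<Pi>\<^sub>M b\<in>insert u B. lborel))
        = (\<integral>\<^sup>+t. \<integral>\<^sup>+c. ?ind ((c(u := t))(a := h)) \<partial>?P \<partial>lborel)"
      by (rule product_nn_integral_insert_rev[OF B'(1) notin(1) ind'])
  qed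
  also have "\<dots> = (\<integral>\<^sup>+h. \<integral>\<^sup>+t. indicator {0..1 :: real} h * (indicator {0..1 / s} t * ennreal ((s * t) ^ (?N - 2)) * section_vol a) \<partial>lborel \<partial>lborel)"
  proof (rule nn_integral_cong, rule nn_integral_cong_AE)
    fix h :: real
    have "(\<integral>\<^sup>+c. ?ind ((c(u := t))(a := h)) \<partial>?P)
      = indicator {0..1} h * (indicator {0..1 / s} t * ennreal ((s * t) ^ (?N - 2)) * section_vol a)" if "t \<noteq> 0" for t
    proof -
      let ?S = "{c \<in> space ?P. \<forall>j. (t *\<^sub>R u + ?v c) $ j \<ge> 0}"
      have "(\<lambda>c. t *\<^sub>R u + ?v c) \<in> ?P \<rightarrow>\<^sub>M borel" by measurable
      moreover have "{x :: real ^ 'n. \<forall>j. x $ j \<ge> 0} \<in> sets borel"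
        by (intro borel_closed closed_Collect_all closed_Collect_le continuous_intros)
      ultimately have "(\<lambda>c. t *\<^sub>R u + ?v c) -` {x. \<forall>j. x $ j \<ge> 0} \<inter> space ?P \<in> sets ?P"
        by (rule measurable_sets)
      then have S: "?S \<in> sets ?P"
        by (simp add: vimage_def Int_def conj_commute)
      have mem: "?f ((c(u := t))(a := h)) \<in> cone_prism a \<longleftrightarrow>
          h \<in> {0..1} \<and> t \<le> 1 / s \<and> (\<forall>j. (t *\<^sub>R u + ?v c) $ j \<ge> 0)" for c
      proof -
        have "(\<Sum>b\<in>B. ((c(u := t))(a := h)) b *\<^sub>R b) = ?v c"
          using notin by (intro sum.cong) auto
        then have f: "?f ((c(u := t))(a := h)) = h *\<^sub>R a + (t *\<^sub>R u + ?v c)"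
          using notin B'(1) by auto
        define W where "W = t *\<^sub>R u + ?v c"
        have "a \<bullet> (h *\<^sub>R a + W) = h"
          using vV[of c] aa au by (simp add: V inner_add_right W_def)
        moreover have "(\<Sum>j\<in>UNIV. (h *\<^sub>R a + W) $ j) = s * t"
          using vV[of c] sum_a sum_u by (simp add: V_def sum.distrib sum_distrib_left[symmetric] W_def)
        moreover have "s * t \<le> 1 \<longleftrightarrow> t \<le> 1 / s"
          using s by (simp add: field_simps)
        ultimately show ?thesis
          unfolding f W_def[symmetric] cone_prism_def mem_Collect_eq by auto
      qed
      have "(\<integral>\<^sup>+c. ?ind ((c(u := t))(a := h)) \<partial>?P)
          = (\<integral>\<^sup>+c. indicator {0..1} h * indicator {..1 / s} t * indicator ?S c \<partial>?P)"
      proof (rule nn_integral_cong)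
        fix c assume c: "c \<in> space ?P"
        define Q where "Q \<longleftrightarrow> (\<forall>j. (t *\<^sub>R u + ?v c) $ j \<ge> 0)"
        have "c \<in> ?S \<longleftrightarrow> Q"
          using c unfolding Q_def by blast
        then show "?ind ((c(u := t))(a := h)) = indicator {0..1} h * indicator {..1 / s} t * indicator ?S c"
          unfolding indicator_def mem Q_def[symmetric] by simp
      qed
      also have "\<dots> = indicator {0..1} h * indicator {..1 / s} t * emeasure ?P ?S"
        using S by (intro nn_integral_cmult_indicator)
      also have "\<dots> = indicator {0..1} h * (indicator {0..1 / s} t * ennreal ((s * t) ^ (?N - 2)) * section_vol a)"
      proof (cases "t > 0")
        case True
        then have "indicator {..1 / s} t = (indicator {0..1 / s} t :: ennreal)"
          by (simp add: indicator_def)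
        then show ?thesis by (simp only: slice[OF True] mult.assoc)
      next
        case False
        with that have "t < 0" by simp
        then have "indicator {0..1 / s} t = (0 :: ennreal)"
          by (simp add: indicator_def)
        then show ?thesis
          by (simp only: slice_neg[OF \<open>t < 0\<close>] emeasure_empty mult_zero_right mult_zero_left)
      qed
      finally show ?thesis .
    qed
    \<comment> \<open>The scaling argument excludes the single value $t = 0$.\<close>
    then show "AE t in lborel. (\<integral>\<^sup>+c. ?ind ((c(u := t))(a := h)) \<partial>?P)
      = indicator {0..1} h * (indicator {0..1 / s} t * ennreal ((s * t) ^ (?N - 2)) * section_vol a)"
      by (intro eventually_mono[OF AE_lborel_singleton[of "0 :: real"]])
  qed
  also have "\<dots> = (\<integral>\<^sup>+t. indicator {0..1 / s} t * ennreal ((s * t) ^ (?N - 2)) * section_vol a \<partial>lborel)"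
    (is "_ = (\<integral>\<^sup>+t. ?F t \<partial>lborel)")
  proof -
    have F: "?F \<in> borel_measurable lborel" by measurable
    have "(\<integral>\<^sup>+h. \<integral>\<^sup>+t. indicator {0..1 :: real} h * ?F t \<partial>lborel \<partial>lborel)
        = (\<integral>\<^sup>+h. indicator {0..1 :: real} h * (\<integral>\<^sup>+t. ?F t \<partial>lborel) \<partial>lborel)"
      by (intro nn_integral_cong nn_integral_cmult F)
    also have "\<dots> = (\<integral>\<^sup>+h. indicator {0..1 :: real} h \<partial>lborel) * (\<integral>\<^sup>+t. ?F t \<partial>lborel)"
      by (intro nn_integral_multc) auto
    also have "(\<integral>\<^sup>+h. indicator {0..1 :: real} h \<partial>lborel) = 1"
      by simp
    finally show ?thesis by (simp only: mult_1)
  qed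
  also have "\<dots> = (\<integral>\<^sup>+t. indicator {0..1 / s} t * ennreal ((s * t) ^ (?N - 2)) \<partial>lborel) * section_vol a"
    by (intro nn_integral_multc) measurable
  also have "\<dots> = slice_integral ?N * section_vol a"
    unfolding slice_integral_def s_def by (simp only: mult.commute)
  finally show ?thesis .
qed

lemma slice_integral_pos_finite:
  assumes "N \<ge> 1"
  shows "slice_integral N \<noteq> 0" "slice_integral N \<noteq> \<infinity>"
proof -
  let ?f = "\<lambda>t. ennreal ((sqrt N * t) ^ (N - 2)) * indicator {0..1 / sqrt N} t"
  have "\<not> (AE t in lborel. ?f t = 0)"
  proof
    assume "AE t in lborel. ?f t = 0"
    then have "AE t in lborel. \<not> t \<in> {0<..<1 / sqrt N}"
      using assms by (auto simp: indicator_def elim!: eventually_mono)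
    then have "{0<..<1 / sqrt N} \<in> null_sets lborel"
      by (subst AE_iff_null_sets) auto
    then have "emeasure lborel {0<..<1 / sqrt N} = 0"
      by (rule null_setsD1)
    then show False using assms by simp
  qed
  then show "slice_integral N \<noteq> 0"
    unfolding slice_integral_def by (subst nn_integral_0_iff_AE) auto
  have "slice_integral N \<le> (\<integral>\<^sup>+t. indicator {0..1 / sqrt N} t \<partial>lborel)"
    unfolding slice_integral_def
  proof (intro nn_integral_mono)
    fix t :: real
    have "(sqrt N * t) ^ (N - 2) \<le> 1" if "t \<in> {0..1 / sqrt N}"
    proof -
      have "sqrt N * t \<le> 1" using that assms by (simp add: field_simps)
      then show ?thesis using that by (intro power_le_one) auto
    qed
    then show "ennreal ((sqrt N * t) ^ (N - 2)) * indicator {0..1 / sqrt N} t \<le> indicator {0..1 / sqrt N} t"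
      by (auto simp: indicator_def)
  qed
  also have "\<dots> = ennreal (1 / sqrt N)"
    by simp
  also have "\<dots> < \<infinity>" by simp
  finally show "slice_integral N \<noteq> \<infinity>" by simp
qed

lemma section_vol_le_iff:
  fixes a b :: "real ^ 'n::finite"
  assumes "norm a = 1" "(\<Sum>j\<in>UNIV. a $ j) = 0" "norm b = 1" "(\<Sum>j\<in>UNIV. b $ j) = 0"
  shows "section_vol a \<le> section_vol b \<longleftrightarrow> emeasure lborel (cone_prism a) \<le> emeasure lborel (cone_prism b)"
proof -
  have "CARD('n) \<ge> 1"
    using zero_less_card_finite[where 'a='n] by linarith
  note k = slice_integral_pos_finite[OF this]
  show ?thesis
    unfolding emeasure_cone_prism[OF assms(1,2)] emeasure_cone_prism[OF assms(3,4)]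
    using k by (intro ennreal_mult_le_mult_iff[symmetric]) auto
qed

section \<open>The volume of the prism\<close>

text \<open>
  A simplex with $n$ mutually orthogonal edges at the origin, times a unit segment in coordinate $i$.
\<close>

definition corner :: "'n \<Rightarrow> ('n \<Rightarrow> real) \<Rightarrow> (real ^ 'n) set" where
  "corner i m = {y. (\<forall>j. j \<noteq> i \<longrightarrow> 0 \<le> y $ j) \<and> (\<Sum>j\<in>-{i}. m j * y $ j) \<le> 1 \<and> 0 \<le> y $ i \<and> y $ i \<le> 1}"

definition corner_vol :: "'n::finite \<Rightarrow> real" where
  "corner_vol i = measure lborel (corner i (\<lambda>_. 1) :: (real ^ 'n) set)"

text \<open>
  The prism in new coordinates: the $i$-th one is $\langle a, y \rangle$, and the others are those
  of the projection of $y$ to the hyperplane. The missing $i$-th coordinate of the projection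
  is $-\sum_{j\ne i} a_j z_j / a_i$; its nonnegativity and the bound on the coordinate sum give the
  two inequalities.
\<close>

definition chamber :: "'n \<Rightarrow> real ^ 'n \<Rightarrow> (real ^ 'n) set" where
  "chamber i a = {z. (\<forall>j. j \<noteq> i \<longrightarrow> 0 \<le> z $ j) \<and> (\<Sum>j\<in>-{i}. a $ j * z $ j) \<le> 0
      \<and> (\<Sum>j\<in>-{i}. (1 - a $ j / a $ i) * z $ j) \<le> 1 \<and> 0 \<le> z $ i \<and> z $ i \<le> 1}"

lemma sum_split: "(\<Sum>j\<in>UNIV. f j) = f i + (\<Sum>j\<in>-{i}. f j)" for f :: "'n::finite \<Rightarrow> real"
  using sum.remove[of UNIV i f] by (simp add: Compl_eq_Diff_UNIV)

lemma inner_split: "a \<bullet> y = a $ i * y $ i + (\<Sum>j\<in>-{i}. a $ j * y $ j)" for a :: "real ^ 'n::finite"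
  using sum_split[of "\<lambda>j. a $ j * y $ j" i] by (simp add: inner_vec_def)

lemma compact_corner:
  fixes m :: "'n::finite \<Rightarrow> real"
  assumes m: "\<And>j. j \<noteq> i \<Longrightarrow> m j > 0"
  shows "compact (corner i m)"
proof -
  have "closed (corner i m)"
    unfolding corner_def imp_conv_disj
    by (intro closed_Collect_conj closed_Collect_all closed_Collect_disj closed_Collect_le closed_Collect_const continuous_intros)
  moreover have "corner i m \<subseteq> cbox 0 (\<chi> j. if j = i then 1 else 1 / m j)"
  proof
    fix y assume y: "y \<in> corner i m"
    have "y $ j \<le> 1 / m j" if "j \<noteq> i" for j
    proof -
      have "m j * y $ j \<le> (\<Sum>j\<in>-{i}. m j * y $ j)"
        using y m that by (intro member_le_sum) (auto simp: corner_def less_imp_le)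
      also have "\<dots> \<le> 1" using y by (simp add: corner_def)
      finally show ?thesis using m[OF that] by (simp add: field_simps)
    qed
    then show "y \<in> cbox 0 (\<chi> j. if j = i then 1 else 1 / m j)"
      using y by (auto simp: corner_def mem_box_cart)
  qed
  ultimately show ?thesis
    using bounded_subset[OF bounded_cbox] compact_eq_bounded_closed by blast
qed

lemma measure_corner:
  fixes m :: "'n::finite \<Rightarrow> real"
  assumes m: "\<And>j. j \<noteq> i \<Longrightarrow> m j > 0"
  shows "measure lborel (corner i m) = corner_vol i / (\<Prod>j\<in>-{i}. m j)"
proof -
  let ?k = "\<lambda>j. if j = i then 1 else 1 / m j"
  let ?S = "corner i (\<lambda>_. 1) :: (real ^ 'n) set"
  have S: "compact ?S" by (rule compact_corner) simp
  have eq: "(\<lambda>x. \<chi> j. ?k j * x $ j) ` ?S = corner i m"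
  proof (intro set_eqI iffI)
    fix y assume "y \<in> (\<lambda>x. \<chi> j. ?k j * x $ j) ` ?S"
    then obtain x where x: "x \<in> ?S" "y = (\<chi> j. ?k j * x $ j)" by blast
    have "(\<Sum>j\<in>-{i}. m j * y $ j) = (\<Sum>j\<in>-{i}. x $ j)"
      using m x(2) by (intro sum.cong) (auto simp: less_imp_neq[symmetric])
    then show "y \<in> corner i m"
      using x m by (auto simp: corner_def less_imp_le)
  next
    fix y assume y: "y \<in> corner i m"
    define x where "x = (\<chi> j. if j = i then y $ i else m j * y $ j)"
    have "(\<Sum>j\<in>-{i}. x $ j) = (\<Sum>j\<in>-{i}. m j * y $ j)"
      by (intro sum.cong) (auto simp: x_def)
    then have "x \<in> ?S"
      using y m by (auto simp: corner_def x_def less_imp_le)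
    moreover have "y = (\<chi> j. ?k j * x $ j)"
      using m by (auto simp: x_def vec_eq_iff less_imp_neq[symmetric])
    ultimately show "y \<in> (\<lambda>x. \<chi> j. ?k j * x $ j) ` ?S" by blast
  qed
  have "measure lebesgue (corner i m) = \<bar>prod ?k UNIV\<bar> * measure lebesgue ?S"
    using measure_stretch[OF lmeasurable_compact[OF S], of ?k] unfolding eq .
  moreover have "measure lebesgue (corner i m) = measure lborel (corner i m)"
    using borel_compact[OF compact_corner[of i m, OF m]] by simp
  moreover have "measure lebesgue ?S = corner_vol i"
    unfolding corner_vol_def using borel_compact[OF S] by simp
  moreover have "prod ?k UNIV = 1 / (\<Prod>j\<in>-{i}. m j)"
  proof -
    have "prod ?k UNIV = ?k i * prod ?k (-{i})"
      using prod.remove[of UNIV i ?k] by (simp add: Compl_eq_Diff_UNIV)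
    also have "prod ?k (-{i}) = (\<Prod>j\<in>-{i}. 1 / m j)"
      by (intro prod.cong) auto
    finally show ?thesis by (simp add: prod_dividef)
  qed
  moreover have "(\<Prod>j\<in>-{i}. m j) > 0"
    using m by (intro prod_pos) auto
  ultimately show ?thesis by (simp add: abs_if)
qed

text \<open>
  A transposition of coordinates is orthogonal. This makes values of the prism volume comparable
  when different coordinates are distinguished.
\<close>

lemma corner_vol_eq:
  fixes i k :: "'n::finite"
  shows "corner_vol i = corner_vol k"
proof -
  let ?t = "Transposition.transpose i k"
  define f where "f x = (\<chi> j. x $ ?t j)" for x :: "real ^ 'n"
  have bt: "bij_betw ?t UNIV UNIV" by simp
  have bc: "bij_betw ?t (-{k}) (-{i})"
    by (auto simp: bij_betw_def inj_on_def image_iff Transposition.transpose_def split: if_splits)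
  have "linear f"
    by (intro linearI) (auto simp: f_def vec_eq_iff)
  moreover have "f x \<bullet> f y = x \<bullet> y" for x y
    using sum.reindex_bij_betw[OF bt, of "\<lambda>j. x $ j * y $ j"] by (simp add: f_def inner_vec_def)
  ultimately have "orthogonal_transformation f"
    by (simp add: orthogonal_transformation_def)
  note d = distr_orthogonal_transformation[OF this]
  have mf: "f \<in> borel_measurable borel"
    using \<open>linear f\<close> by (intro borel_measurable_continuous_onI linear_continuous_on linear_conv_bounded_linear[THEN iffD1])
  have c: "compact (corner k (\<lambda>_. 1) :: (real ^ 'n) set)" by (rule compact_corner) simp
  have "f -` corner k (\<lambda>_. 1) = corner i (\<lambda>_. 1)"
  proof (intro set_eqI)
    fix x
    have "(\<Sum>j\<in>-{k}. f x $ j) = (\<Sum>j\<in>-{i}. x $ j)"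
      using sum.reindex_bij_betw[OF bc, of "\<lambda>j. x $ j"] by (simp add: f_def)
    moreover have "(\<forall>j. j \<noteq> k \<longrightarrow> 0 \<le> f x $ j) \<longleftrightarrow> (\<forall>j. j \<noteq> i \<longrightarrow> 0 \<le> x $ j)"
      unfolding f_def by (simp, metis transpose_apply_first transpose_apply_second transpose_involutory)
    moreover have "f x $ k = x $ i" by (simp add: f_def)
    ultimately show "x \<in> f -` corner k (\<lambda>_. 1) \<longleftrightarrow> x \<in> corner i (\<lambda>_. 1)"
      by (simp add: corner_def)
  qed
  then have "measure (distr lborel borel f) (corner k (\<lambda>_. 1)) = measure lborel (corner i (\<lambda>_. 1) :: (real ^ 'n) set)"
    using mf c by (subst measure_distr) (auto intro: borel_compact)
  then show ?thesis
    unfolding d corner_vol_def by simp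
qed

lemma compact_cone_prism:
  fixes a :: "real ^ 'n::finite"
  assumes norm_a: "norm a = 1" and sum_a: "(\<Sum>j\<in>UNIV. a $ j) = 0"
  shows "compact (cone_prism a)"
proof -
  have "cone_prism a \<subseteq> cbox (\<chi> j. - 2) (\<chi> j. 2)"
  proof
    fix y assume y: "y \<in> cone_prism a"
    let ?x = "y - (a \<bullet> y) *\<^sub>R a"
    have "(\<Sum>j\<in>UNIV. ?x $ j) \<le> 1"
      using y sum_a by (simp add: cone_prism_def sum_subtractf sum_distrib_left[symmetric])
    moreover have x0: "0 \<le> ?x $ j" for j
      using y unfolding cone_prism_def by blast
    ultimately have x1: "?x $ j \<le> 1" for j
      using member_le_sum[of j UNIV "\<lambda>j. ?x $ j"] by (metis UNIV_I finite_class.finite_UNIV order_trans DiffE)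
    have "\<bar>(a \<bullet> y) * a $ j\<bar> \<le> 1" for j
    proof -
      have "\<bar>a $ j\<bar> \<le> 1" using component_le_norm_cart[of a j] norm_a by simp
      moreover have "\<bar>a \<bullet> y\<bar> \<le> 1" using y by (simp add: cone_prism_def)
      ultimately show ?thesis by (simp add: abs_mult mult_le_one)
    qed
    then have "-2 \<le> y $ j \<and> y $ j \<le> 2" for j
      using x0[of j] x1[of j] by (simp add: abs_le_iff) (smt (verit))
    then show "y \<in> cbox (\<chi> j. - 2) (\<chi> j. 2)"
      by (simp add: mem_box_cart)
  qed
  then show ?thesis
    using bounded_subset[OF bounded_cbox] closed_cone_prism compact_eq_bounded_closed by blast
qed

text \<open>
  The coordinate change is a composition of two rank-one updates: a shear in a direction orthogonal
  to $a$, which has determinant $1$, and the replacement of one coordinate by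
  $\langle a, y \rangle$, which has determinant $a_i$.
\<close>

lemma measure_chamber:
  fixes a :: "real ^ 'n::finite"
  assumes norm_a: "norm a = 1" and sum_a: "(\<Sum>j\<in>UNIV. a $ j) = 0" and ai: "a $ i > 0"
  shows "compact (chamber i a)" "measure lborel (chamber i a) = a $ i * measure lborel (cone_prism a)"
proof -
  define f where "f = (\<lambda>y. y + (a \<bullet> y) *\<^sub>R (axis i (1 / a $ i) - a))"
  define g where "g = (\<lambda>y. y + ((a - axis i 1) \<bullet> y) *\<^sub>R axis i (1 :: real))"
  have aa: "a \<bullet> a = 1" using norm_a by (simp add: dot_square_norm)
  have d: "a \<bullet> (axis i (1 / a $ i) - a) = 0"
    using ai aa by (simp add: inner_diff_right inner_axis)
  have af: "a \<bullet> f y = a \<bullet> y" for y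
    using d by (simp add: f_def inner_add_right)
  have gi: "g y $ i = a \<bullet> y" for y
    by (simp add: g_def inner_diff_left inner_axis inner_axis')
  have gj: "g y $ j = y $ j" if "j \<noteq> i" for y j
    using that by (simp add: g_def axis_def)
  have fj: "f y $ j = (y - (a \<bullet> y) *\<^sub>R a) $ j" if "j \<noteq> i" for y j
    using that by (simp add: f_def axis_def algebra_simps)
  have h: "g (f y) $ j = (if j = i then a \<bullet> y else (y - (a \<bullet> y) *\<^sub>R a) $ j)" for y j
    by (simp add: gi gj fj af)
  have eq: "g ` f ` cone_prism a = chamber i a"
  proof (intro set_eqI iffI)
    fix z assume "z \<in> g ` f ` cone_prism a"
    then obtain y where y: "y \<in> cone_prism a" "z = g (f y)" by blast
    define x where "x = y - (a \<bullet> y) *\<^sub>R a"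
    have x: "a \<bullet> x = 0" "(\<Sum>j\<in>UNIV. x $ j) \<le> 1" "\<And>j. 0 \<le> x $ j"
      using y(1) aa sum_a unfolding x_def
      by (auto simp: cone_prism_def inner_diff_right sum_subtractf sum_distrib_left[symmetric])
    have zj: "z $ j = x $ j" if "j \<noteq> i" for j using y(2) h that by (simp add: x_def)
    have zi: "z $ i = a \<bullet> y" using y(2) h by simp
    have s: "(\<Sum>j\<in>-{i}. a $ j * z $ j) = - (a $ i * x $ i)"
    proof -
      have "(\<Sum>j\<in>-{i}. a $ j * z $ j) = (\<Sum>j\<in>-{i}. a $ j * x $ j)"
        by (intro sum.cong) (auto simp: zj)
      then show ?thesis using x(1) inner_split[of a x i] by simp
    qed
    have "(\<Sum>j\<in>-{i}. (1 - a $ j / a $ i) * z $ j)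
        = (\<Sum>j\<in>-{i}. z $ j) - (\<Sum>j\<in>-{i}. a $ j * z $ j) / a $ i"
      by (simp add: left_diff_distrib sum_subtractf sum_divide_distrib)
    also have "\<dots> = (\<Sum>j\<in>-{i}. x $ j) + x $ i"
      using ai unfolding s by (simp add: zj)
    also have "\<dots> \<le> 1"
      using x(2) sum_split[of "\<lambda>j. x $ j" i] by simp
    finally show "z \<in> chamber i a"
      using s x(3) ai y(1) zj zi by (simp add: chamber_def cone_prism_def)
  next
    fix z assume z: "z \<in> chamber i a"
    define x where "x = (\<chi> j. if j = i then - (\<Sum>j\<in>-{i}. a $ j * z $ j) / a $ i else z $ j)"
    define y where "y = x + z $ i *\<^sub>R a"
    have "(\<Sum>j\<in>-{i}. a $ j * x $ j) = (\<Sum>j\<in>-{i}. a $ j * z $ j)"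
      by (intro sum.cong) (auto simp: x_def)
    then have ax: "a \<bullet> x = 0"
      using ai inner_split[of a x i] by (simp add: x_def)
    then have ay: "a \<bullet> y = z $ i"
      using aa by (simp add: y_def inner_add_right)
    have x: "y - (a \<bullet> y) *\<^sub>R a = x"
      unfolding ay by (simp add: y_def)
    have x0: "0 \<le> x $ j" for j
      using z ai by (auto simp: x_def chamber_def divide_nonpos_pos)
    have "(\<Sum>j\<in>UNIV. y $ j) = (\<Sum>j\<in>UNIV. x $ j)"
      using sum_a by (simp add: y_def sum.distrib sum_distrib_left[symmetric])
    also have "\<dots> = - (\<Sum>j\<in>-{i}. a $ j * z $ j) / a $ i + (\<Sum>j\<in>-{i}. z $ j)"
      using sum_split[of "\<lambda>j. x $ j" i] by (simp add: x_def)
    also have "\<dots> = (\<Sum>j\<in>-{i}. (1 - a $ j / a $ i) * z $ j)"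
      by (simp add: left_diff_distrib sum_subtractf sum_divide_distrib)
    also have "\<dots> \<le> 1" using z by (simp add: chamber_def)
    finally have "(\<Sum>j\<in>UNIV. y $ j) \<le> 1" .
    moreover have "0 \<le> z $ i" "z $ i \<le> 1"
      using z by (auto simp: chamber_def)
    ultimately have "y \<in> cone_prism a"
      using x0 unfolding cone_prism_def mem_Collect_eq x unfolding ay by blast
    moreover have "z = g (f y)"
      unfolding vec_eq_iff h x unfolding ay by (simp add: x_def)
    ultimately show "z \<in> g ` f ` cone_prism a" by blast
  qed
  have cont: "continuous_on A f" "continuous_on A g" for A
    unfolding f_def g_def by (intro continuous_intros)+
  note P = compact_cone_prism[OF norm_a sum_a]
  have fP: "compact (f ` cone_prism a)"
    using P by (rule compact_continuous_image[OF cont(1)])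
  show "compact (chamber i a)"
    unfolding eq[symmetric] using fP by (rule compact_continuous_image[OF cont(2)])
  have "measure lborel (chamber i a) = measure lborel (g ` f ` cone_prism a)"
    by (simp add: eq)
  also have "\<dots> = \<bar>1 + (a - axis i 1) \<bullet> axis i 1\<bar> * measure lborel (f ` cone_prism a)"
    unfolding g_def by (rule measure_rank_one_update[OF fP])
  also have "measure lborel (f ` cone_prism a) = \<bar>1 + a \<bullet> (axis i (1 / a $ i) - a)\<bar> * measure lborel (cone_prism a)"
    unfolding f_def by (rule measure_rank_one_update[OF P])
  finally show "measure lborel (chamber i a) = a $ i * measure lborel (cone_prism a)"
    using ai by (simp add: d inner_diff_left inner_axis inner_axis')
qed

lemma measure_cone_prism_one_positive:
  fixes a :: "real ^ 'n::finite"
  assumes norm_a: "norm a = 1" and sum_a: "(\<Sum>j\<in>UNIV. a $ j) = 0" and ai: "a $ i > 0"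
    and neg: "\<And>j. j \<noteq> i \<Longrightarrow> a $ j \<le> 0"
  shows "measure lborel (cone_prism a) = corner_vol i / (a $ i * (\<Prod>j\<in>-{i}. 1 - a $ j / a $ i))"
proof -
  have "(\<Sum>j\<in>-{i}. a $ j * z $ j) \<le> 0" if "\<And>j. j \<noteq> i \<Longrightarrow> 0 \<le> z $ j" for z :: "real ^ 'n"
    using neg that by (intro sum_nonpos mult_nonpos_nonneg) auto
  then have "chamber i a = corner i (\<lambda>j. 1 - a $ j / a $ i)"
    unfolding chamber_def corner_def by blast
  moreover have "1 - a $ j / a $ i > 0" if "j \<noteq> i" for j
    using neg[OF that] ai by (simp add: field_simps)
  ultimately have "measure lborel (chamber i a) = corner_vol i / (\<Prod>j\<in>-{i}. 1 - a $ j / a $ i)"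
    by (simp add: measure_corner)
  then show ?thesis
    using measure_chamber(2)[OF norm_a sum_a ai] ai
    by (metis divide_divide_eq_left' less_irrefl nonzero_mult_div_cancel_left)
qed

text \<open>
  In the chamber only $z_k$ occurs with a positive coefficient in $\sum a_j z_j \le 0$. So the
  chamber contains the points of a corner for which $z_k$ is at most a linear form $\langle w, z\rangle$
  in the other coordinates, and shearing by this form identifies the remaining points with a second
  corner. For $\varepsilon = 1 - a_k/a_i$ nothing is lost. When $a_i = a_k$ this value is $0$
  and both corners are unbounded, which is why the estimate is stated for all larger
  $\varepsilon$.
\<close>

lemma measure_cone_prism_two_positive_approx:
  fixes a :: "real ^ 'n::finite"
  assumes norm_a: "norm a = 1" and sum_a: "(\<Sum>j\<in>UNIV. a $ j) = 0" and ik: "i \<noteq> k"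
    and ak: "0 < a $ k" and ki: "a $ k \<le> a $ i"
    and neg: "\<And>j. j \<noteq> i \<Longrightarrow> j \<noteq> k \<Longrightarrow> a $ j \<le> 0"
    and e: "e > 0" "e \<ge> 1 - a $ k / a $ i"
  shows "a $ i * measure lborel (cone_prism a) \<ge> corner_vol i / e *
     (1 / (\<Prod>j\<in>-{i, k}. 1 - a $ j / a $ i) - 1 / (\<Prod>j\<in>-{i, k}. 1 - a $ j / a $ i - e * a $ j / a $ k))"
proof -
  have ai: "a $ i > 0" using ak ki by simp
  define m where "m = (\<lambda>j. if j = k then e else 1 - a $ j / a $ i)"
  define m' where "m' = (\<lambda>j. if j = k then e else 1 - a $ j / a $ i - e * a $ j / a $ k)"
  define w :: "real ^ 'n" where "w = (\<chi> j. if j = i \<or> j = k then 0 else - a $ j / a $ k)"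
  define f where "f = (\<lambda>y. y + (w \<bullet> y) *\<^sub>R axis k (1 :: real))"
  have w0: "0 \<le> w $ j" for j
    using neg[of j] ak by (auto simp: w_def divide_nonpos_pos)
  have mpos: "m j > 0" if "j \<noteq> i" for j
    using that neg[of j] ai e(1) divide_nonpos_pos[of "a $ j" "a $ i"] by (auto simp: m_def)
  have mm': "m' j = m j + e * w $ j" if "j \<noteq> i" for j
    using that by (simp add: m_def m'_def w_def)
  have m'pos: "m' j > 0" if "j \<noteq> i" for j
    using mpos[OF that] w0[of j] e(1) unfolding mm'[OF that] by (intro add_pos_nonneg) auto
  have split_k: "(\<Sum>j\<in>-{i}. h j) = h k + (\<Sum>j\<in>-{i, k}. h j)" for h :: "'n \<Rightarrow> real"
    using sum.remove[of "-{i}" k h] ik by (simp add: Compl_eq_Diff_UNIV Diff_insert2[symmetric] insert_commute)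
  have w_inner: "w \<bullet> z = (\<Sum>j\<in>-{i, k}. w $ j * z $ j)" for z
    using inner_split[of w z i] split_k[of "\<lambda>j. w $ j * z $ j"] by (simp add: w_def)
  have sub: "corner i m \<subseteq> chamber i a \<union> f ` corner i m'"
  proof
    fix z assume z: "z \<in> corner i m"
    show "z \<in> chamber i a \<union> f ` corner i m'"
    proof (cases "z $ k \<le> w \<bullet> z")
      case True
      have "(\<Sum>j\<in>-{i, k}. a $ j * z $ j) = - (a $ k * (w \<bullet> z))"
        unfolding w_inner sum_distrib_left sum_negf[symmetric]
        using ak by (intro sum.cong) (auto simp: w_def)
      then have "(\<Sum>j\<in>-{i}. a $ j * z $ j) = a $ k * (z $ k - w \<bullet> z)"
        unfolding split_k by (simp add: algebra_simps)
      also have "\<dots> \<le> 0"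
        using True ak by (simp add: mult_nonneg_nonpos)
      finally have 1: "(\<Sum>j\<in>-{i}. a $ j * z $ j) \<le> 0" .
      have "(\<Sum>j\<in>-{i}. (1 - a $ j / a $ i) * z $ j) \<le> (\<Sum>j\<in>-{i}. m j * z $ j)"
        using z e(2) by (intro sum_mono mult_right_mono) (auto simp: m_def corner_def)
      also have "\<dots> \<le> 1" using z by (simp add: corner_def)
      finally show ?thesis
        using 1 z by (simp add: chamber_def corner_def)
    next
      case False
      define y where "y = z - (w \<bullet> z) *\<^sub>R axis k 1"
      have wy: "w \<bullet> y = w \<bullet> z"
        by (simp add: y_def inner_diff_right inner_axis w_def)
      have yk: "y $ k = z $ k - w \<bullet> z" and yj: "\<And>j. j \<noteq> k \<Longrightarrow> y $ j = z $ j"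
        by (auto simp: y_def axis_def)
      have "(\<Sum>j\<in>-{i}. m' j * y $ j) = e * (z $ k - w \<bullet> z) + (\<Sum>j\<in>-{i, k}. m' j * z $ j)"
        unfolding split_k by (simp add: yk yj m'_def)
      also have "(\<Sum>j\<in>-{i, k}. m' j * z $ j) = (\<Sum>j\<in>-{i, k}. m j * z $ j) + e * (w \<bullet> z)"
        unfolding w_inner sum_distrib_left sum.distrib[symmetric]
        by (intro sum.cong) (auto simp: mm' algebra_simps)
      also have "e * (z $ k - w \<bullet> z) + ((\<Sum>j\<in>-{i, k}. m j * z $ j) + e * (w \<bullet> z)) = (\<Sum>j\<in>-{i}. m j * z $ j)"
        unfolding split_k by (simp add: m_def algebra_simps)
      also have "\<dots> \<le> 1" using z by (simp add: corner_def)
      finally have "(\<Sum>j\<in>-{i}. m' j * y $ j) \<le> 1" .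
      moreover have "0 \<le> y $ j" if "j \<noteq> i" for j
        using z that False yk yj[of j] by (cases "j = k") (auto simp: corner_def)
      ultimately have "y \<in> corner i m'"
        using z ik yj[of i] by (simp add: corner_def)
      moreover have "z = f y"
        unfolding f_def wy by (simp add: y_def)
      ultimately show ?thesis by blast
    qed
  qed
  have cm: "compact (corner i m)" "compact (corner i m')"
    using compact_corner mpos m'pos by blast+
  note ch = measure_chamber[OF norm_a sum_a ai]
  have cf: "compact (f ` corner i m')"
    unfolding f_def using cm(2) by (intro compact_continuous_image continuous_intros)
  have "measure lborel (corner i m) \<le> measure lborel (chamber i a \<union> f ` corner i m')"
    using sub cm ch(1) cf by (intro measure_mono_fmeasurable fmeasurable_compact borel_compact compact_Un)
      (auto intro: borel_compact)
  also have "\<dots> \<le> measure lborel (chamber i a) + measure lborel (f ` corner i m')"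
    using ch(1) cf by (intro measure_Un_le) (auto intro: borel_compact)
  also have "measure lborel (f ` corner i m') = measure lborel (corner i m')"
  proof -
    have "w \<bullet> axis k 1 = 0" by (simp add: inner_axis w_def)
    then show ?thesis
      unfolding f_def using measure_rank_one_update[OF cm(2), of w "axis k 1"] by simp
  qed
  finally have "a $ i * measure lborel (cone_prism a) \<ge> measure lborel (corner i m) - measure lborel (corner i m')"
    unfolding ch(2) by simp
  moreover have split_prod: "(\<Prod>j\<in>-{i}. h j) = h k * (\<Prod>j\<in>-{i, k}. h j)" for h :: "'n \<Rightarrow> real"
    using prod.remove[of "-{i}" k h] ik by (simp add: Compl_eq_Diff_UNIV Diff_insert2[symmetric] insert_commute)
  have "measure lborel (corner i m) = corner_vol i / e * (1 / (\<Prod>j\<in>-{i, k}. 1 - a $ j / a $ i))"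
    using mpos by (simp add: measure_corner split_prod) (simp add: m_def)
  moreover have "measure lborel (corner i m') = corner_vol i / e * (1 / (\<Prod>j\<in>-{i, k}. 1 - a $ j / a $ i - e * a $ j / a $ k))"
    using m'pos by (simp add: measure_corner split_prod) (simp add: m'_def)
  ultimately show ?thesis
    by (simp add: right_diff_distrib)
qed

text \<open>
  The function $G$ is the divided difference of $Q$ with its removable singularity filled in;
  $G(a_k)$ is the density at $0$ of $\sum a_j E_j$ for independent standard exponential variables
  $E_j$. If $a_i = a_k$, the bounds for $t < a_i$ are passed to the limit $t \to a_i$.
\<close>

lemma measure_cone_prism_two_positive:
  fixes a :: "real ^ 'n::finite"
  defines "Q \<equiv> \<lambda>i k t. (\<Prod>j\<in>-{i, k}. t / (t - a $ j))"
  assumes norm_a: "norm a = 1" and sum_a: "(\<Sum>j\<in>UNIV. a $ j) = 0" and ik: "i \<noteq> k"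
    and ak: "0 < a $ k" and ki: "a $ k \<le> a $ i"
    and neg: "\<And>j. j \<noteq> i \<Longrightarrow> j \<noteq> k \<Longrightarrow> a $ j \<le> 0"
    and G: "\<And>t. 0 < t \<Longrightarrow> (a $ i - t) * G t = Q i k (a $ i) - Q i k t"
    and cont: "isCont G (a $ k)"
  shows "measure lborel (cone_prism a) \<ge> corner_vol i * G (a $ k)"
proof -
  define x where "x = a $ i"
  define v where "v = corner_vol i"
  have x: "x > 0" using ak ki by (simp add: x_def)
  have Q: "1 / (\<Prod>j\<in>-{i, k}. 1 - a $ j / t) = Q i k t" if "t > 0" for t
  proof -
    have "1 / (1 - a $ j / t) = t / (t - a $ j)" for j
      using that by (simp add: field_simps)
    then show ?thesis
      unfolding Q_def using prod_dividef[of "\<lambda>_. 1" "\<lambda>j. 1 - a $ j / t" "-{i, k}"] by simp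
  qed
  have approx: "v / e * (1 / (\<Prod>j\<in>-{i, k}. 1 - a $ j / x) - 1 / (\<Prod>j\<in>-{i, k}. 1 - a $ j / x - e * a $ j / a $ k))
      \<le> x * measure lborel (cone_prism a)" if "e > 0" "e \<ge> 1 - a $ k / x" for e
    unfolding x_def v_def
    by (rule measure_cone_prism_two_positive_approx[OF norm_a sum_a ik ak ki])
       (use neg that in \<open>auto simp: x_def\<close>)
  show ?thesis
  proof (cases "a $ k = x")
    case False
    then have kx: "a $ k < x" using ki by (simp add: x_def)
    define e where "e = 1 - a $ k / x"
    have e: "e > 0" using kx x by (simp add: e_def)
    have h: "1 - a $ j / x - e * a $ j / a $ k = 1 - a $ j / a $ k" for j
      using x ak by (simp add: e_def field_simps)
    have "e \<ge> 1 - a $ k / x" by (simp add: e_def)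
    from approx[OF e this]
    have "x * measure lborel (cone_prism a) \<ge> v / e * (Q i k x - Q i k (a $ k))"
      unfolding h Q[OF x] Q[OF ak] .
    also have "v / e * (Q i k x - Q i k (a $ k)) = x * (v * G (a $ k))"
    proof -
      have "x - a $ k = x * e" using x by (simp add: e_def field_simps)
      then show ?thesis
        using G[OF ak, folded x_def, symmetric] e by simp
    qed
    finally show ?thesis
      using x by (simp add: v_def)
  next
    case True
    have "measure lborel (cone_prism a) \<ge> v * (t / x * G t)" if t: "0 < t" "t < x" for t
    proof -
      define e where "e = x / t - 1"
      have e: "e > 0" "e \<ge> 1 - a $ k / x" using t True x by (auto simp: e_def field_simps)
      have h: "1 - a $ j / x - e * a $ j / a $ k = 1 - a $ j / t" for j
        using x t True by (simp add: e_def field_simps)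
      from approx[OF e]
      have "x * measure lborel (cone_prism a) \<ge> v / e * (Q i k x - Q i k t)"
        unfolding h Q[OF x] Q[OF t(1)] .
      also have "v / e * (Q i k x - Q i k t) = x * (v * (t / x * G t))"
      proof -
        have "x - t = t * e" using t by (simp add: e_def field_simps)
        then show ?thesis
          using G[OF t(1), folded x_def, symmetric] e x by simp
      qed
      finally show ?thesis
        by (simp only: mult_le_cancel_left_pos[OF x])
    qed
    then have ev: "eventually (\<lambda>t. v * (t / x * G t) \<le> measure lborel (cone_prism a)) (at_left x)"
      using eventually_at_left_real[OF x] by (auto elim!: eventually_mono)
    have "(G \<longlongrightarrow> G x) (at_left x)"
      using cont True by (simp add: isCont_def tendsto_within_subset[OF _ subset_UNIV])
    then have "((\<lambda>t. v * (t / x * G t)) \<longlongrightarrow> v * (x / x * G x)) (at_left x)"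
      using x by (intro tendsto_intros) auto
    then have "v * (x / x * G x) \<le> measure lborel (cone_prism a)"
      using ev by (rule tendsto_upperbound) simp
    then show ?thesis
      using x True by (simp add: v_def)
  qed
qed

section \<open>Inequalities for sign patterns with two positive coordinates\<close>

lemma schur_inequality:
  fixes b c d :: real
  assumes "0 \<le> b" "0 \<le> c" "0 \<le> d"
  shows "b * (b - c) * (b - d) + c * (c - b) * (c - d) + d * (d - b) * (d - c) \<ge> 0"
proof -
  have ordered: "x * (x - y) * (x - z) + y * (y - x) * (y - z) + z * (z - x) * (z - y) \<ge> 0"
    if "x \<ge> y" "y \<ge> z" "z \<ge> 0" for x y z :: real
  proof -
    have "x * (x - y) * (x - z) + y * (y - x) * (y - z) + z * (z - x) * (z - y)
        = (x - y) * ((x - y) * (x + y - z)) + z * ((x - z) * (y - z))"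
      by (simp add: algebra_simps)
    moreover have "(x - y) * ((x - y) * (x + y - z)) \<ge> 0" "z * ((x - z) * (y - z)) \<ge> 0"
      using that by (intro mult_nonneg_nonneg; simp)+
    ultimately show ?thesis by simp
  qed
  consider "b \<ge> c" "c \<ge> d" | "b \<ge> d" "d \<ge> c" | "c \<ge> b" "b \<ge> d" | "c \<ge> d" "d \<ge> b" | "d \<ge> b" "b \<ge> c" | "d \<ge> c" "c \<ge> b"
    by linarith
  then show ?thesis
    using ordered[of b c d] ordered[of b d c] ordered[of c b d] ordered[of c d b] ordered[of d b c] ordered[of d c b] assms
    by cases (simp_all add: algebra_simps)
qed

text \<open>
  Here $p$ stands for the product of the two positive coordinates and $q, r$ for the second and third
  elementary symmetric functions of the negatives of the others, all scaled to sum $1$. The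
  difference of the two sides is concave in $r$, so only the ends of the interval allowed for $r$
  matter. There it is a polynomial in $p$ and $q$, and its expansion in Bernstein polynomials on
  the relevant rectangle has nonnegative coefficients.
\<close>

lemma two_three_polynomial_bound:
  fixes p q r :: real
  assumes p: "0 \<le> p" "p \<le> 1/4" and q: "0 \<le> q" "q \<le> 1/3"
    and r: "0 \<le> r" "4 * q - 1 \<le> 9 * r" "9 * r \<le> q"
  shows "458/1000 * (p^3 + 2 * p^2 + q * p * (2 - 2 * p) + r * (2 - 5 * p) + q^2 * p + q * r + r^2)
    \<le> (141/100 - 855/1000 * (p + q)) * (p^2 + q * p + r * (1 - p))"
proof -
  define F where "F r = (141/100 - 855/1000 * (p + q)) * (p^2 + q * p + r * (1 - p))
     - 458/1000 * (p^3 + 2 * p^2 + q * p * (2 - 2 * p) + r * (2 - 5 * p) + q^2 * p + q * r + r^2)" for r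
  let ?u = "1/4 - p" and ?v = "1/3 - q"
  have u: "0 \<le> ?u" and v: "0 \<le> ?v" using p q by auto
  note nonneg = mult_nonneg_nonneg add_nonneg_nonneg zero_le_power
  have concave: "F ((1 - t) * l + t * h) = (1 - t) * F l + t * F h + 458/1000 * (t * (1 - t) * (h - l)^2)" for t l h
    by (simp add: F_def field_simps power2_eq_square)
  \<comment> \<open>The expansion in Bernstein polynomials, here and below, is cleared of denominators.\<close>
  have hi: "F (q / 9) \<ge> 0"
  proof -
    have "81000 * F (q / 9) = 853632 * (1/4 - p)^3 * q * (1/3 - q) + 68032 * (1/4 - p)^3 * q^2 + 4492368 * p * (1/4 - p)^2 * q * (1/3 - q) + 557040 * p * (1/4 - p)^2 * q^2 + 1440504 * p^2 * (1/4 - p) * (1/3 - q)^2 + 8625420 * p^2 * (1/4 - p) * q * (1/3 - q) + 1671060 * p^2 * (1/4 - p) * q^2 + 483327 * p^3 * (1/3 - q)^2 + 3072330 * p^3 * q * (1/3 - q) + 224875 * p^3 * q^2"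
      by (simp add: F_def field_simps eval_nat_numeral)
    also have "\<dots> \<ge> 0"
      using p q u v by (intro nonneg) auto
    finally show ?thesis by simp
  qed
  have between: "F r \<ge> 0" if "F l \<ge> 0" "l \<le> r" "l < q / 9" for l
  proof -
    define t where "t = (r - l) / (q / 9 - l)"
    have t: "0 \<le> t" "t \<le> 1" using that r by (auto simp: t_def field_simps)
    have "t * (q / 9 - l) = r - l" using that(3) by (simp add: t_def)
    then have "r = (1 - t) * l + t * (q / 9)" by (simp add: algebra_simps)
    then have "F r = (1 - t) * F l + t * F (q / 9) + 458/1000 * (t * (1 - t) * (q / 9 - l)^2)"
      using concave[of t l "q / 9"] by simp
    also have "\<dots> \<ge> 0"
      using that hi t by (intro nonneg) auto
    finally show ?thesis .
  qed
  have "F r \<ge> 0"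
  proof (cases "r = q / 9")
    case True
    show ?thesis unfolding True by (rule hi)
  next
    case False
    then have rq: "r < q / 9" using r by simp
    show ?thesis
    proof (cases "q \<le> 1/4")
      case True
      have "125 * F 0 = p * (3952 * (1/4 - p)^2 * q * (1/4 - q) + 1326 * (1/4 - p)^2 * q^2 + 3952 * p * (1/4 - p) * (1/4 - q)^2 + 14220 * p * (1/4 - p) * q * (1/4 - q) + 5016 * p * (1/4 - p) * q^2 + 1326 * p^2 * (1/4 - q)^2 + 5016 * p^2 * q * (1/4 - q) + 1064 * p^2 * q^2)"
        by (simp add: F_def field_simps eval_nat_numeral)
      also have "\<dots> \<ge> 0"
        using p q u True by (intro nonneg) auto
      finally have "F 0 \<ge> 0" by simp
      then show ?thesis using between[of 0] r rq by simp
    next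
      case False
      then have w: "0 \<le> q - 1/4" by simp
      have "10125 * F ((4 * q - 1) / 9) = 572832 * (1/4 - p)^3 * (q - 1/4) * (1/3 - q) + 136064 * (1/4 - p)^3 * (q - 1/4)^2 + 966654 * p * (1/4 - p)^2 * (1/3 - q)^2 + 3542184 * p * (1/4 - p)^2 * (q - 1/4) * (1/3 - q) + 1114080 * p * (1/4 - p)^2 * (q - 1/4)^2 + 3656664 * p^2 * (1/4 - p) * (1/3 - q)^2 + 8611380 * p^2 * (1/4 - p) * (q - 1/4) * (1/3 - q) + 3342120 * p^2 * (1/4 - p) * (q - 1/4)^2 + 775656 * p^3 * (1/3 - q)^2 + 1813320 * p^3 * (q - 1/4) * (1/3 - q) + 449750 * p^3 * (q - 1/4)^2"
        by (simp add: F_def field_simps eval_nat_numeral)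
      also have "\<dots> \<ge> 0"
        using p u v w by (intro nonneg) auto
      finally have "F ((4 * q - 1) / 9) \<ge> 0" by simp
      then show ?thesis using between[of "(4 * q - 1) / 9"] r rq by simp
    qed
  qed
  then show ?thesis by (simp add: F_def)
qed

text \<open>
  With $S = x + y$ the quantity is $S^{-1}$ times a rational function of $p, q, r$, and the
  normalisation gives $S^{-2} = 2 - 2 p - 2 q$. Since $p + q \le 7/12$, the square root is bounded
  below by a linear function, close to a chord, which leads to the preceding polynomial
  inequality. The constraints on $r$ come from Schur's inequality and from
  $e_1 e_2 \ge 9 e_3$.
\<close>

lemma two_three_density_bound:
  fixes x y b c d :: real
  assumes pos: "0 < x" "0 < y" "0 \<le> b" "0 \<le> c" "0 \<le> d"
    and sum: "x + y = b + c + d" and norm: "x^2 + y^2 + b^2 + c^2 + d^2 = 1"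
  shows "458/1000 \<le> ((b + c + d) * x^2 * y^2 + (b * c + b * d + c * d) * x * y * (x + y) + b * c * d * (x^2 + x * y + y^2))
     / ((x + b) * (x + c) * (x + d) * (y + b) * (y + c) * (y + d))"
proof -
  define S where "S = x + y"
  have S: "S > 0" using pos by (simp add: S_def)
  define x' y' b' c' d' where defs: "x' = x / S" "y' = y / S" "b' = b / S" "c' = c / S" "d' = d / S"
  have scale: "x = S * x'" "y = S * y'" "b = S * b'" "c = S * c'" "d = S * d'"
    using S by (auto simp: defs)
  have pos': "0 < x'" "0 < y'" "0 \<le> b'" "0 \<le> c'" "0 \<le> d'"
    using pos S by (auto simp: defs)
  have x'y': "y' = 1 - x'"
    using S by (simp add: defs S_def field_simps)
  have b'c'd': "d' = 1 - b' - c'"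
  proof -
    have "b' + c' + d' = (b + c + d) / S" by (simp add: defs add_divide_distrib)
    then show ?thesis using S sum by (simp add: S_def)
  qed
  define p q r where pqr: "p = x' * y'" "q = b' * c' + b' * d' + c' * d'" "r = b' * c' * d'"
  have p: "0 < p" "p \<le> 1/4"
    using pos' sum_squares_ge_zero[of "x' - y'" 0] unfolding pqr x'y' by (auto simp: algebra_simps)
  have "0 \<le> (b' - c')^2 + (b' - d')^2 + (c' - d')^2" by simp
  then have q: "0 \<le> q" "q \<le> 1/3"
    using pos' unfolding pqr by (simp, simp add: b'c'd' power2_eq_square algebra_simps)
  have "0 \<le> b' * (c' - d')^2 + c' * (b' - d')^2 + d' * (b' - c')^2"
    using pos' by simp
  then have r9: "9 * r \<le> q"
    unfolding pqr b'c'd' by (simp add: power2_eq_square algebra_simps)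
  have r: "0 \<le> r" using pos' by (simp add: pqr)
  have rs: "4 * q - 1 \<le> 9 * r"
    using schur_inequality[OF pos'(3-5)] unfolding pqr b'c'd' by (simp add: algebra_simps)
  let ?N = "p^2 + q * p + r * (1 - p)"
  let ?D = "p^3 + 2 * p^2 + q * p * (2 - 2 * p) + r * (2 - 5 * p) + q^2 * p + q * r + r^2"
  let ?l = "141/100 - 855/1000 * (p + q)"
  have num: "(b + c + d) * x^2 * y^2 + (b * c + b * d + c * d) * x * y * (x + y) + b * c * d * (x^2 + x * y + y^2) = S^5 * ?N"
    unfolding scale pqr b'c'd' x'y' by (simp add: algebra_simps eval_nat_numeral)
  have den: "(x + b) * (x + c) * (x + d) * (y + b) * (y + c) * (y + d) = S^6 * ?D"
    unfolding scale pqr b'c'd' x'y' by (simp add: algebra_simps eval_nat_numeral)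
  have "(1 / S)^2 = 2 - 2 * p - 2 * q"
  proof -
    have "S^2 * (2 - 2 * p - 2 * q) = 1"
      using norm unfolding scale pqr b'c'd' x'y' by (simp add: algebra_simps eval_nat_numeral)
    then show ?thesis using S by (simp add: field_simps power_divide)
  qed
  moreover have "?l^2 \<le> 2 - 2 * p - 2 * q"
  proof -
    have "2 - 2 * s - (141/100 - 855/1000 * s)^2 \<ge> 0" if "0 \<le> s" "s \<le> 7/12" for s :: real
    proof -
      \<comment> \<open>The difference is concave in $s$: it is its chord on $[0, 7/12]$ plus a multiple of $s (7/12 - s)$.\<close>
      have "2 - 2 * s - (141/100 - 855/1000 * s)^2
          = (119/10000) * (1 - 12 / 7 * s) + s * (12 / 7 * (2 - 7/6 - (141/100 - 855/1000 * (7/12))^2) + (855/1000)^2 * (7/12 - s))"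
        by (simp add: field_simps power2_eq_square)
      also have "\<dots> \<ge> 0"
        using that by (intro add_nonneg_nonneg mult_nonneg_nonneg) (auto simp: power2_eq_square)
      finally show ?thesis .
    qed
    from this[of "p + q"] show ?thesis using p q by simp
  qed
  ultimately have l: "?l \<le> 1 / S"
    using S power2_le_imp_le[of ?l "1 / S"] by simp
  have N: "0 \<le> ?N" using p q r by simp
  have "0 < (x + b) * (x + c) * (x + d) * (y + b) * (y + c) * (y + d)"
    using pos by (intro mult_pos_pos) auto
  then have D: "0 < ?D"
    using S by (simp only: den zero_less_mult_iff) (auto simp: zero_less_power)
  have "458/1000 * ?D \<le> ?l * ?N"
    using p q r r9 rs by (intro two_three_polynomial_bound) auto
  also have "\<dots> \<le> 1 / S * ?N"
    using l N by (rule mult_right_mono)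
  finally have "458/1000 \<le> 1 / S * ?N / ?D"
    using D by (simp only: pos_le_divide_eq)
  also have "\<dots> = (S^5 * ?N) / (S^6 * ?D)"
  proof -
    have "1 / S * n / d = (S^5 * n) / (S^6 * d)" for n d :: real
      using S by (simp add: divide_simps eval_nat_numeral)
    then show ?thesis .
  qed
  finally show ?thesis
    unfolding num den .
qed

text \<open>
  The quantity depends only on $T = xy + bc$ and $D = xy - bc$, because the normalisation determines
  $S = x + y$ by $S^2 = (1 + 2T)/2$. It decreases in $|D|$, which is at most $T$ and at most
  $(1 - 2T)/4$; the first bound is used for small $T$, the second for large $T$.
\<close>

lemma two_two_density_bound:
  fixes x y b c :: real
  assumes pos: "0 < x" "0 < y" "0 \<le> b" "0 \<le> c"
    and sum: "x + y = b + c" and norm: "x^2 + y^2 + b^2 + c^2 = 1"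
  shows "4872/10000 \<le> (x * y * (b + c) + b * c * (x + y)) / ((x + b) * (x + c) * (y + b) * (y + c))"
proof -
  define S where "S = x + y"
  define T where "T = x * y + b * c"
  define D where "D = x * y - b * c"
  have S: "S > 0" and T: "T > 0" using pos by (auto simp: S_def T_def add_pos_nonneg)
  have y: "y = S - x" and c: "c = S - b" using sum by (auto simp: S_def)
  have S2: "S^2 = (1 + 2 * T) / 2"
    using norm unfolding T_def y c by (simp add: power2_eq_square field_simps)
  have num: "x * y * (b + c) + b * c * (x + y) = S * T"
    unfolding T_def y c by (simp add: algebra_simps)
  have den: "(x + b) * (x + c) * (y + b) * (y + c) = D^2 + T * (1 + 2 * T)"
  proof -
    have "(x + b) * (x + c) * (y + b) * (y + c) = D^2 + 2 * S^2 * T"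
      unfolding D_def T_def y c by (simp add: algebra_simps power2_eq_square)
    then show ?thesis unfolding S2 by simp
  qed
  have "4 * (x * y) \<le> S^2" "4 * (b * c) \<le> S^2"
    using sum_squares_ge_zero[of "x - y" 0] sum_squares_ge_zero[of "b - c" 0]
    unfolding y c by (auto simp: algebra_simps power2_eq_square)
  then have D1: "\<bar>D\<bar> \<le> (1 - 2 * T) / 4"
  proof -
    have "\<bar>P - Q\<bar> \<le> (1 - 2 * (P + Q)) / 4" if "4 * P \<le> (1 + 2 * (P + Q)) / 2" "4 * Q \<le> (1 + 2 * (P + Q)) / 2" for P Q :: real
      using that by (simp add: abs_if)
    from this[of "x * y" "b * c"] \<open>4 * (x * y) \<le> S^2\<close> \<open>4 * (b * c) \<le> S^2\<close>
    show ?thesis unfolding S2 unfolding T_def D_def by simp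
  qed
  have D2: "\<bar>D\<bar> \<le> T"
    using pos unfolding T_def D_def by (simp add: abs_le_iff)
  have T2: "T \<le> 1/2" using D1 by simp
  have "(7/10 + 6/10 * T)^2 \<le> S^2"
  proof -
    have "S^2 - (7/10 + 6/10 * T)^2 = (1/100) * (1 - 2 * T) + 36/100 * T * (1/2 - T)"
      unfolding S2 by (simp add: field_simps power2_eq_square)
    also have "\<dots> \<ge> 0" using T T2 by (intro add_nonneg_nonneg mult_nonneg_nonneg) auto
    finally show ?thesis by simp
  qed
  then have l: "7/10 + 6/10 * T \<le> S"
    using S by (auto intro: power2_le_imp_le)
  have "4872/10000 * (D^2 + T * (1 + 2 * T)) \<le> (7/10 + 6/10 * T) * T"
  proof (cases "T \<le> 1/6")
    case True
    have "D^2 \<le> T^2" using D2 T by (simp add: abs_le_square_iff[symmetric])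
    then have "4872/10000 * (D^2 + T * (1 + 2 * T)) \<le> 4872/10000 * (T^2 + T * (1 + 2 * T))"
      by simp
    also have "\<dots> = (7/10 + 6/10 * T) * T - T * (2128/10000 - 8616/10000 * T)"
      by (simp add: field_simps power2_eq_square)
    also have "\<dots> \<le> (7/10 + 6/10 * T) * T"
      using T True by simp
    finally show ?thesis .
  next
    case False
    have "D^2 \<le> ((1 - 2 * T) / 4)^2" using D1 T2 by (simp add: abs_le_square_iff[symmetric])
    then have "4872/10000 * (D^2 + T * (1 + 2 * T)) \<le> 4872/10000 * (((1 - 2 * T) / 4)^2 + T * (1 + 2 * T))"
      by simp
    \<comment> \<open>The subtracted term is concave in $T$: its chord on $[1/6, 1/2]$ plus a multiple of $(T - 1/6)(1/2 - T)$.\<close>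
    also have "\<dots> = (7/10 + 6/10 * T) * T - (4962/10000 * (T - 1/6) * (1/2 - T) + 173/15000 + 19/5000 * (T - 1/6))"
      by (simp add: field_simps power2_eq_square)
    also have "\<dots> \<le> (7/10 + 6/10 * T) * T"
    proof -
      have "0 \<le> 4962/10000 * (T - 1/6) * (1/2 - T) + 173/15000 + 19/5000 * (T - 1/6)"
        using False T2 by (intro add_nonneg_nonneg mult_nonneg_nonneg) auto
      then show ?thesis by linarith
    qed
    finally show ?thesis .
  qed
  also have "\<dots> \<le> S * T"
    using l T by (intro mult_right_mono) auto
  finally have main: "4872/10000 * (D^2 + T * (1 + 2 * T)) \<le> S * T" .
  have "0 < D^2 + T * (1 + 2 * T)"
    using T by (intro add_nonneg_pos mult_pos_pos) auto
  then show ?thesis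
    unfolding num den using main by (simp only: pos_le_divide_eq)
qed

section \<open>Minimality\<close>

lemma a_min_properties:
  fixes i :: "'n::finite"
  assumes n: "n \<ge> 1" and card: "CARD('n) = n + 1"
  shows "a_min n i $ i = sqrt (real n / (real n + 1))"
    and "\<And>j. j \<noteq> i \<Longrightarrow> a_min n i $ j = - (a_min n i $ i / real n)"
    and "0 < a_min n i $ i"
    and "(\<Sum>j\<in>UNIV. a_min n i $ j) = 0"
    and "norm (a_min n i) = 1"
proof -
  let ?a = "a_min n i :: real ^ 'n"
  show ai: "?a $ i = sqrt (real n / (real n + 1))"
    by (simp add: a_min_def)
  then show pos: "0 < ?a $ i"
    using n by simp
  have sq: "sqrt (real n / (real n + 1)) = real n / sqrt (real n * (real n + 1))"
  proof -
    have "real n / (real n + 1) = (real n)^2 / (real n * (real n + 1))"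
      using n by (simp add: power2_eq_square)
    then show ?thesis by (simp add: real_sqrt_divide)
  qed
  show aj: "?a $ j = - (?a $ i / real n)" if "j \<noteq> i" for j
    using that n unfolding ai sq by (simp add: a_min_def)
  have cardi: "card (-{i}) = n"
    using card by (simp add: Compl_eq_Diff_UNIV card_Diff_subset)
  have "(\<Sum>j\<in>-{i}. ?a $ j) = (\<Sum>j\<in>-{i}. - (?a $ i / real n))"
    by (intro sum.cong refl aj) simp
  then show "(\<Sum>j\<in>UNIV. ?a $ j) = 0"
    using n cardi by (simp add: sum_split[of _ i])
  have "(\<Sum>j\<in>-{i}. ?a $ j * ?a $ j) = (\<Sum>j\<in>-{i}. (?a $ i)^2 / (real n)^2)"
    by (intro sum.cong refl) (simp add: aj power2_eq_square)
  then have "?a \<bullet> ?a = (?a $ i)^2 * (1 + 1 / real n)"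
    unfolding inner_split[of ?a ?a i] using n cardi by (simp add: power2_eq_square field_simps)
  also have "(?a $ i)^2 = real n / (real n + 1)"
    unfolding ai by simp
  also have "real n / (real n + 1) * (1 + 1 / real n) = 1"
  proof -
    have "1 + 1 / real n = (real n + 1) / real n"
      using n by (simp add: add_divide_distrib)
    then show ?thesis using n by (simp add: add_nonneg_eq_0_iff)
  qed
  finally show "norm ?a = 1"
    by (simp add: norm_eq_1)
qed

lemma measure_cone_prism_a_min:
  fixes i k :: "'n::finite"
  assumes n: "n \<ge> 1" and card: "CARD('n) = n + 1"
  shows "measure lborel (cone_prism (a_min n i :: real ^ 'n))
    = corner_vol k / (sqrt (real n / (real n + 1)) * (1 + 1 / real n) ^ n)"
proof -
  let ?a = "a_min n i :: real ^ 'n"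
  note am = a_min_properties[OF n card, where i = i]
  have "?a $ j \<le> 0" if "j \<noteq> i" for j
    using am(2)[OF that] am(3) n by simp
  then have "measure lborel (cone_prism ?a) = corner_vol i / (?a $ i * (\<Prod>j\<in>-{i}. 1 - ?a $ j / ?a $ i))"
    by (intro measure_cone_prism_one_positive am) auto
  also have "(\<Prod>j\<in>-{i}. 1 - ?a $ j / ?a $ i) = (\<Prod>j\<in>-{i}. 1 + 1 / real n)"
    using am(2,3) n by (intro prod.cong refl) simp
  also have "\<dots> = (1 + 1 / real n) ^ n"
    using card by (simp add: Compl_eq_Diff_UNIV card_Diff_subset)
  finally show ?thesis
    unfolding am(1) corner_vol_eq[of i k] .
qed

text \<open>
  The inequality between arithmetic and geometric means, from $1 + x \le \exp x$ applied to
  $f_j/c - 1$.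
\<close>

lemma prod_le_power_mean:
  fixes f :: "'a \<Rightarrow> real"
  assumes "finite A" "A \<noteq> {}" "\<And>j. j \<in> A \<Longrightarrow> 0 \<le> f j" and c: "c > 0" and s: "sum f A = c * real (card A)"
  shows "prod f A \<le> c ^ card A"
proof -
  have "(\<Prod>j\<in>A. f j / c) \<le> (\<Prod>j\<in>A. exp (f j / c - 1))"
    using assms exp_ge_add_one_self by (intro prod_mono) (smt (verit) divide_nonneg_pos)
  also have "\<dots> = exp (\<Sum>j\<in>A. f j / c - 1)"
    using assms(1) by (simp add: exp_sum)
  also have "(\<Sum>j\<in>A. f j / c - 1) = 0"
    using s c by (simp add: sum_subtractf sum_divide_distrib[symmetric])
  finally show ?thesis
    using c by (simp add: prod_dividef)
qed

text \<open>
  By Cauchy-Schwarz, $a_k^2 \le n \sum_{j \ne k} a_j^2 = n (1 - a_k^2)$, and the factors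
  $1 - a_j/a_k$ have mean $1 + 1/n$. Both factors of the denominator of the volume are thus largest
  at \<open>a_min\<close>.
\<close>

lemma cone_prism_minimal_one_positive:
  fixes a :: "real ^ 'n::finite" and i k :: 'n
  assumes n: "n \<ge> 1" and card: "CARD('n) = n + 1"
    and norm_a: "norm a = 1" and sum_a: "(\<Sum>j\<in>UNIV. a $ j) = 0" and ak: "0 \<le> a $ k"
    and neg: "\<And>j. j \<noteq> k \<Longrightarrow> a $ j \<le> 0"
  shows "measure lborel (cone_prism (a_min n i)) \<le> measure lborel (cone_prism a)"
proof -
  let ?J = "-{k}"
  let ?A = "sqrt (real n / (real n + 1))"
  have cardk: "card ?J = n"
    using card by (simp add: Compl_eq_Diff_UNIV card_Diff_subset)
  have aa: "a \<bullet> a = 1" using norm_a by (simp add: dot_square_norm)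
  have sumJ: "(\<Sum>j\<in>?J. a $ j) = - a $ k"
    using sum_a sum_split[of "\<lambda>j. a $ j" k] by simp
  have sqJ: "(\<Sum>j\<in>?J. (a $ j)^2) = 1 - (a $ k)^2"
    using aa unfolding inner_split[of a a k] by (simp add: power2_eq_square)
  have "(\<Sum>j\<in>?J. a $ j)^2 \<le> real n * (\<Sum>j\<in>?J. (a $ j)^2)"
    using sum_squared_le_sum_of_squares[of "\<lambda>j. a $ j" ?J] by (simp add: cardk mult.commute)
  then have "(a $ k)^2 \<le> real n / (real n + 1)"
    unfolding sumJ sqJ using n by (simp add: field_simps)
  then have kA: "a $ k \<le> ?A"
    using ak by (simp add: real_le_rsqrt)
  have pos: "0 < a $ k"
  proof (rule ccontr)
    assume "\<not> 0 < a $ k"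
    then have k0: "a $ k = 0" using ak by simp
    have "\<forall>j\<in>?J. - a $ j = 0"
      using sumJ neg k0 by (subst sum_nonneg_eq_0_iff[symmetric]) (auto simp: sum_negf)
    then have "(\<Sum>j\<in>?J. (a $ j)^2) = 0" by simp
    then show False using sqJ k0 by simp
  qed
  have "(\<Prod>j\<in>?J. 1 - a $ j / a $ k) \<le> (1 + 1 / real n) ^ card ?J"
  proof (rule prod_le_power_mean)
    show "?J \<noteq> {}" using cardk n by (metis card.empty not_one_le_zero)
    show "0 \<le> 1 - a $ j / a $ k" if "j \<in> ?J" for j
      using neg[of j] that pos divide_nonpos_pos[of "a $ j" "a $ k"] by simp
    show "(\<Sum>j\<in>?J. 1 - a $ j / a $ k) = (1 + 1 / real n) * real (card ?J)"
      using sumJ cardk pos n by (simp add: sum_subtractf sum_divide_distrib[symmetric] field_simps)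
    show "0 < 1 + 1 / real n" by (simp add: add_pos_nonneg)
  qed simp
  then have P: "(\<Prod>j\<in>?J. 1 - a $ j / a $ k) \<le> (1 + 1 / real n) ^ n"
    by (simp only: cardk)
  have P0: "0 < (\<Prod>j\<in>?J. 1 - a $ j / a $ k)"
  proof (rule prod_pos)
    fix j assume "j \<in> ?J"
    then show "0 < 1 - a $ j / a $ k"
      using neg[of j] pos divide_nonpos_pos[of "a $ j" "a $ k"] by simp
  qed
  have "corner_vol k / (?A * (1 + 1 / real n) ^ n) \<le> corner_vol k / (a $ k * (\<Prod>j\<in>?J. 1 - a $ j / a $ k))"
    using kA P P0 pos n by (intro divide_left_mono mult_mono mult_pos_pos) (auto simp: corner_vol_def)
  moreover have "measure lborel (cone_prism a) = corner_vol k / (a $ k * (\<Prod>j\<in>?J. 1 - a $ j / a $ k))"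
    using neg by (rule measure_cone_prism_one_positive[OF norm_a sum_a pos])
  ultimately show ?thesis
    by (simp only: measure_cone_prism_a_min[OF n card, where i = i and k = k])
qed

lemma sum_split2:
  fixes f :: "'n::finite \<Rightarrow> real"
  assumes "i \<noteq> k"
  shows "(\<Sum>j\<in>UNIV. f j) = f i + f k + (\<Sum>j\<in>-{i, k}. f j)"
proof -
  have "UNIV = insert i (insert k (-{i, k}))" by auto
  then have "(\<Sum>j\<in>UNIV. f j) = (\<Sum>j\<in>insert i (insert k (-{i, k})). f j)" by simp
  also have "\<dots> = f i + f k + (\<Sum>j\<in>-{i, k}. f j)" using assms by simp
  finally show ?thesis .
qed

text \<open>
  The constant $0.4872$ of the density bound exceeds the density
  $\sqrt{4/3}\,(3/4)^3 \approx 0.48714$ at \<open>a_min\<close>.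
\<close>

lemma cone_prism_minimal_two_two:
  fixes a :: "real ^ 'n::finite" and i i' k :: 'n
  assumes card: "CARD('n) = 4"
    and norm_a: "norm a = 1" and sum_a: "(\<Sum>j\<in>UNIV. a $ j) = 0" and ik: "i' \<noteq> k"
    and ak: "0 < a $ k" and ki: "a $ k \<le> a $ i'"
    and neg: "\<And>j. j \<noteq> i' \<Longrightarrow> j \<noteq> k \<Longrightarrow> a $ j \<le> 0"
  shows "measure lborel (cone_prism (a_min 3 i)) \<le> measure lborel (cone_prism a)"
proof -
  have "card (-{i', k}) = 2" using card ik by (simp add: Compl_eq_Diff_UNIV card_Diff_subset)
  then obtain l m where lm: "-{i', k} = {l, m}" "l \<noteq> m" by (meson card_2_iff)
  then have J: "l \<noteq> i'" "l \<noteq> k" "m \<noteq> i'" "m \<noteq> k" by auto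
  define x y b c where xy: "x = a $ i'" "y = a $ k" "b = - a $ l" "c = - a $ m"
  have pos: "0 < x" "0 < y" "0 \<le> b" "0 \<le> c"
    using ak ki neg J by (auto simp: xy)
  have sum: "x + y = b + c"
    using sum_a sum_split2[OF ik, of "\<lambda>j. a $ j"] lm by (simp add: xy)
  have "a \<bullet> a = 1" using norm_a by (simp add: dot_square_norm)
  then have norm: "x^2 + y^2 + b^2 + c^2 = 1"
    using sum_split2[OF ik, of "\<lambda>j. a $ j * a $ j"] lm by (simp add: xy inner_vec_def power2_eq_square)
  define G where "G t = (x * t * (b + c) + b * c * (x + t)) / ((x + b) * (x + c) * (t + b) * (t + c))" for t
  have "corner_vol i' * G (a $ k) \<le> measure lborel (cone_prism a)"
  proof (rule measure_cone_prism_two_positive[OF norm_a sum_a ik ak ki neg])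
    fix t :: real assume t: "0 < t"
    have nz: "x + b \<noteq> 0" "x + c \<noteq> 0" "t + b \<noteq> 0" "t + c \<noteq> 0"
      using pos t by linarith+
    have "(x - t) * G t = x / (x + b) * (x / (x + c)) - t / (t + b) * (t / (t + c))"
      using nz unfolding G_def by (simp add: divide_simps) (simp add: algebra_simps)
    then show "(a $ i' - t) * G t = (\<Prod>j\<in>-{i', k}. a $ i' / (a $ i' - a $ j)) - (\<Prod>j\<in>-{i', k}. t / (t - a $ j))"
      using lm by (simp add: xy)
  next
    show "isCont G (a $ k)"
      using pos unfolding G_def xy(2)[symmetric] by (intro continuous_intros) simp
  qed
  note lower = this
  have G: "4872/10000 \<le> G (a $ k)"
    using two_two_density_bound[OF pos sum norm] by (simp add: G_def xy)
  have "measure lborel (cone_prism (a_min 3 i :: real ^ 'n)) = corner_vol i' / (sqrt (real 3 / (real 3 + 1)) * (1 + 1 / real 3) ^ 3)"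
    using card by (intro measure_cone_prism_a_min) simp_all
  also have "\<dots> \<le> corner_vol i' * (4872/10000)"
  proof -
    have "866/1000 \<le> sqrt (real 3 / (real 3 + 1))"
      by (rule real_le_rsqrt) (simp add: power2_eq_square)
    then have "10000/4872 \<le> sqrt (real 3 / (real 3 + 1)) * (1 + 1 / real 3) ^ 3"
      by (simp add: eval_nat_numeral)
    then have "corner_vol i' / (sqrt (real 3 / (real 3 + 1)) * (1 + 1 / real 3) ^ 3) \<le> corner_vol i' / (10000/4872)"
      by (intro divide_left_mono) (auto simp: corner_vol_def)
    then show ?thesis by simp
  qed
  also have "\<dots> \<le> corner_vol i' * G (a $ k)"
    using G by (intro mult_left_mono) (simp_all add: corner_vol_def)
  also note lower
  finally show ?thesis .
qed

text \<open>
  The constant $0.458$ of the density bound exceeds the density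
  $\sqrt{5/4}\,(4/5)^4 \approx 0.45795$ at \<open>a_min\<close>.
\<close>

lemma cone_prism_minimal_two_three:
  fixes a :: "real ^ 'n::finite" and i i' k :: 'n
  assumes card: "CARD('n) = 5"
    and norm_a: "norm a = 1" and sum_a: "(\<Sum>j\<in>UNIV. a $ j) = 0" and ik: "i' \<noteq> k"
    and ak: "0 < a $ k" and ki: "a $ k \<le> a $ i'"
    and neg: "\<And>j. j \<noteq> i' \<Longrightarrow> j \<noteq> k \<Longrightarrow> a $ j \<le> 0"
  shows "measure lborel (cone_prism (a_min 4 i)) \<le> measure lborel (cone_prism a)"
proof -
  have "card (-{i', k}) = 3" using card ik by (simp add: Compl_eq_Diff_UNIV card_Diff_subset)
  then obtain l m o' where lm: "-{i', k} = {l, m, o'}" "l \<noteq> m" "l \<noteq> o'" "m \<noteq> o'" by (metis card_3_iff)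
  then have J: "l \<noteq> i'" "l \<noteq> k" "m \<noteq> i'" "m \<noteq> k" "o' \<noteq> i'" "o' \<noteq> k" by auto
  define x y b c d where xy: "x = a $ i'" "y = a $ k" "b = - a $ l" "c = - a $ m" "d = - a $ o'"
  have pos: "0 < x" "0 < y" "0 \<le> b" "0 \<le> c" "0 \<le> d"
    using ak ki neg J by (auto simp: xy)
  have sum: "x + y = b + c + d"
    using sum_a sum_split2[OF ik, of "\<lambda>j. a $ j"] lm by (simp add: xy)
  have "a \<bullet> a = 1" using norm_a by (simp add: dot_square_norm)
  then have norm: "x^2 + y^2 + b^2 + c^2 + d^2 = 1"
    using sum_split2[OF ik, of "\<lambda>j. a $ j * a $ j"] lm by (simp add: xy inner_vec_def power2_eq_square)
  define G where "G t = ((b + c + d) * x^2 * t^2 + (b * c + b * d + c * d) * x * t * (x + t) + b * c * d * (x^2 + x * t + t^2))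
     / ((x + b) * (x + c) * (x + d) * (t + b) * (t + c) * (t + d))" for t
  have "corner_vol i' * G (a $ k) \<le> measure lborel (cone_prism a)"
  proof (rule measure_cone_prism_two_positive[OF norm_a sum_a ik ak ki neg])
    fix t :: real assume t: "0 < t"
    have nz: "x + b \<noteq> 0" "x + c \<noteq> 0" "x + d \<noteq> 0" "t + b \<noteq> 0" "t + c \<noteq> 0" "t + d \<noteq> 0"
      using pos t by linarith+
    have "x / (x + b) * (x / (x + c) * (x / (x + d))) - t / (t + b) * (t / (t + c) * (t / (t + d)))
        = (x^3 * ((t + b) * (t + c) * (t + d)) - t^3 * ((x + b) * (x + c) * (x + d)))
          / ((x + b) * (x + c) * (x + d) * ((t + b) * (t + c) * (t + d)))"
      using nz by (simp add: diff_frac_eq eval_nat_numeral mult_ac)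
    also have "x^3 * ((t + b) * (t + c) * (t + d)) - t^3 * ((x + b) * (x + c) * (x + d))
        = (x - t) * ((b + c + d) * x^2 * t^2 + (b * c + b * d + c * d) * x * t * (x + t) + b * c * d * (x^2 + x * t + t^2))"
      by (simp add: algebra_simps eval_nat_numeral)
    finally have "(x - t) * G t = x / (x + b) * (x / (x + c) * (x / (x + d))) - t / (t + b) * (t / (t + c) * (t / (t + d)))"
      by (simp add: G_def mult.assoc)
    then show "(a $ i' - t) * G t = (\<Prod>j\<in>-{i', k}. a $ i' / (a $ i' - a $ j)) - (\<Prod>j\<in>-{i', k}. t / (t - a $ j))"
      using lm by (simp add: xy)
  next
    show "isCont G (a $ k)"
      using pos unfolding G_def xy(2)[symmetric] by (intro continuous_intros) simp
  qed
  note lower = this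
  have G: "458/1000 \<le> G (a $ k)"
    using two_three_density_bound[OF pos sum norm] by (simp add: G_def xy)
  have "measure lborel (cone_prism (a_min 4 i :: real ^ 'n)) = corner_vol i' / (sqrt (real 4 / (real 4 + 1)) * (1 + 1 / real 4) ^ 4)"
    using card by (intro measure_cone_prism_a_min) simp_all
  also have "\<dots> \<le> corner_vol i' * (458/1000)"
  proof -
    have "8944/10000 \<le> sqrt (real 4 / (real 4 + 1))"
      by (rule real_le_rsqrt) (simp add: power2_eq_square)
    then have "1000/458 \<le> sqrt (real 4 / (real 4 + 1)) * (1 + 1 / real 4) ^ 4"
      by (simp add: eval_nat_numeral)
    then have "corner_vol i' / (sqrt (real 4 / (real 4 + 1)) * (1 + 1 / real 4) ^ 4) \<le> corner_vol i' / (1000/458)"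
      by (intro divide_left_mono) (auto simp: corner_vol_def)
    then show ?thesis by simp
  qed
  also have "\<dots> \<le> corner_vol i' * G (a $ k)"
    using G by (intro mult_left_mono) (simp_all add: corner_vol_def)
  also note lower
  finally show ?thesis .
qed

lemma section_vol_le_if_measure_le:
  fixes a b :: "real ^ 'n::finite"
  assumes "norm a = 1" "(\<Sum>j\<in>UNIV. a $ j) = 0" "norm b = 1" "(\<Sum>j\<in>UNIV. b $ j) = 0"
    and "measure lborel (cone_prism a) \<le> measure lborel (cone_prism b)"
  shows "section_vol a \<le> section_vol b"
proof -
  have "emeasure lborel (cone_prism c) = ennreal (measure lborel (cone_prism c))"
    if "norm c = 1" "(\<Sum>j\<in>UNIV. c $ j) = 0" for c :: "real ^ 'n"
    using fmeasurableD2[OF fmeasurable_compact[OF compact_cone_prism[OF that]]]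
    by (simp add: emeasure_eq_ennreal_measure)
  then show ?thesis
    using assms by (simp add: section_vol_le_iff ennreal_leI)
qed

lemma section_vol_uminus: "section_vol (- a) = section_vol a"
  by (simp add: section_vol_def hyperplane0_def)

text \<open>
  The positive and the negative coordinates number at most five together and at least one each. So
  one of the two signs occurs exactly once, or exactly twice with $n \ge 3$.
\<close>

lemma section_vol_minimal_low_dim:
  fixes a :: "real ^ 'n::finite" and i :: 'n
  assumes n: "n \<in> {2, 3, 4}" and card: "CARD('n) = n + 1"
    and norm_a: "norm a = 1" and sum_a: "(\<Sum>j\<in>UNIV. a $ j) = 0"
  shows "section_vol (a_min n i) \<le> section_vol a"
proof -
  have n1: "n \<ge> 1" using n by auto
  note am = a_min_properties[OF n1 card, where i = i]
  have few_positive: "section_vol (a_min n i) \<le> section_vol b"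
    if b: "norm b = 1" "(\<Sum>j\<in>UNIV. b $ j) = 0" and pos: "card {j. 0 < b $ j} = 1 \<or> card {j. 0 < b $ j} = 2 \<and> n \<ge> 3"
    for b :: "real ^ 'n"
    using pos
  proof
    assume "card {j. 0 < b $ j} = 1"
    then obtain k where k: "{j. 0 < b $ j} = {k}" by (auto simp: card_1_singleton_iff)
    then have "0 \<le> b $ k" "\<And>j. j \<noteq> k \<Longrightarrow> b $ j \<le> 0" by (auto simp: not_less[symmetric])
    then have "measure lborel (cone_prism (a_min n i)) \<le> measure lborel (cone_prism b)"
      by (rule cone_prism_minimal_one_positive[OF n1 card b])
    then show ?thesis
      by (rule section_vol_le_if_measure_le[OF am(5,4) b])
  next
    assume c2: "card {j. 0 < b $ j} = 2 \<and> n \<ge> 3"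
    define Q where "Q = {j. 0 < b $ j}"
    have Q: "0 < b $ j \<longleftrightarrow> j \<in> Q" for j by (simp add: Q_def)
    have "card Q = 2" using c2 by (simp add: Q_def)
    then obtain l m where lm: "Q = {l, m}" "l \<noteq> m"
      unfolding card_2_iff by blast
    obtain i' k where k: "i' \<noteq> k" "Q = {i', k}" "b $ k \<le> b $ i'"
    proof (cases "b $ l \<le> b $ m")
      case True
      then show ?thesis using that[of m l] lm by (simp add: insert_commute)
    next
      case False
      then show ?thesis using that[of l m] lm by simp
    qed
    have p: "0 < b $ k" "\<And>j. j \<noteq> i' \<Longrightarrow> j \<noteq> k \<Longrightarrow> b $ j \<le> 0"
      using Q k(2) by (simp, simp add: not_less[symmetric])
    have "n = 3 \<or> n = 4" using n c2 by auto
    then have "measure lborel (cone_prism (a_min n i)) \<le> measure lborel (cone_prism b)"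
    proof
      assume n: "n = 3"
      then have "CARD('n) = 4" using card by simp
      then show ?thesis
        unfolding n using b k(1) p(1) k(3) p(2) by (rule cone_prism_minimal_two_two)
    next
      assume n: "n = 4"
      then have "CARD('n) = 5" using card by simp
      then show ?thesis
        unfolding n using b k(1) p(1) k(3) p(2) by (rule cone_prism_minimal_two_three)
    qed
    then show ?thesis
      by (rule section_vol_le_if_measure_le[OF am(5,4) b])
  qed
  let ?P = "{j. 0 < a $ j}" and ?N = "{j. 0 < (- a) $ j}"
  have nonempty: "{j. 0 < b $ j} \<noteq> {}" if "norm b = 1" "(\<Sum>j\<in>UNIV. b $ j) = 0" for b :: "real ^ 'n"
  proof
    assume "{j. 0 < b $ j} = {}"
    then have "0 \<le> - b $ j" for j by (auto simp: not_less[symmetric])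
    moreover have "(\<Sum>j\<in>UNIV. - b $ j) = 0" using that(2) by (simp add: sum_negf)
    ultimately have "\<forall>j. b $ j = 0"
      by (subst (asm) sum_nonneg_eq_0_iff) auto
    then have "b = 0" by (simp add: vec_eq_iff)
    then show False using that(1) by simp
  qed
  have minus: "norm (- a) = 1" "(\<Sum>j\<in>UNIV. (- a) $ j) = 0"
    using norm_a sum_a by (simp_all add: sum_negf)
  have "card ?P \<noteq> 0" "card ?N \<noteq> 0"
    using nonempty[OF norm_a sum_a] nonempty[OF minus] by auto
  moreover have "card ?P + card ?N \<le> n + 1"
  proof -
    have "card ?P + card ?N = card (?P \<union> ?N)"
      by (rule card_Un_disjoint[symmetric]) auto
    also have "\<dots> \<le> card (UNIV :: 'n set)" by (intro card_mono) auto
    finally show ?thesis using card by simp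
  qed
  moreover have "n \<le> 4" using n by auto
  ultimately consider "card ?P = 1 \<or> card ?P = 2 \<and> n \<ge> 3" | "card ?N = 1 \<or> card ?N = 2 \<and> n \<ge> 3"
    by linarith
  then show ?thesis
  proof cases
    case 1
    then show ?thesis using few_positive[OF norm_a sum_a] by blast
  next
    case 2
    then show ?thesis using few_positive[OF minus] by (simp only: section_vol_uminus)
  qed
qed

theorem theorem3:
  fixes n :: nat and i1 :: "'n::finite"
  assumes "n \<ge> 1" and "CARD('n) = n + 1"
  shows "(\<forall>a :: real ^ 'n.
            norm a = 1 \<and> (\<Sum>j\<in>UNIV. a $ j) = 0 \<and> a $ i1 \<ge> 0 \<and> (\<forall>j. j \<noteq> i1 \<longrightarrow> a $ j \<le> 0)
            \<longrightarrow> section_vol a \<ge> section_vol (a_min n i1))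
       \<and> (n \<in> {2, 3, 4} \<longrightarrow>
          (\<forall>a :: real ^ 'n.
            norm a = 1 \<and> (\<Sum>j\<in>UNIV. a $ j) = 0
            \<longrightarrow> section_vol a \<ge> section_vol (a_min n i1)))"
proof (intro conjI allI impI)
  fix a :: "real ^ 'n"
  assume a: "norm a = 1 \<and> (\<Sum>j\<in>UNIV. a $ j) = 0 \<and> a $ i1 \<ge> 0 \<and> (\<forall>j. j \<noteq> i1 \<longrightarrow> a $ j \<le> 0)"
  note am = a_min_properties(4,5)[OF assms, where i = i1]
  have "measure lborel (cone_prism (a_min n i1)) \<le> measure lborel (cone_prism a)"
    using a by (intro cone_prism_minimal_one_positive[OF assms, where k = i1]) auto
  with a show "section_vol (a_min n i1) \<le> section_vol a"
    by (intro section_vol_le_if_measure_le[OF am(2,1)]) auto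
next
  fix a :: "real ^ 'n"
  assume "n \<in> {2, 3, 4}" "norm a = 1 \<and> (\<Sum>j\<in>UNIV. a $ j) = 0"
  then show "section_vol (a_min n i1) \<le> section_vol a"
    using section_vol_minimal_low_dim[OF _ assms(2)] by blast
qed

end
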